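(* With step size $\eta=1/L$, projected gradient descent on $\mathcal{C}_\sigma$ over $\mathcal{D}$, started from any point of $\mathcal{D}$, reaches an $\epsilon$-projected-critical point in $\mathcal{O}\!\left(\frac{\alpha L}{\epsilon^2}\right)$ iterations; i.e., within $\mathcal{O}(\alpha L/\epsilon^2)$ iterations some iterate $(a^{(t)},b^{(t)})$ satisfies $\|g(a^{(t)},b^{(t)})\|^2\le\epsilon^2$.
   Context: Truth values: $-1$ = True, $+1$ = False. Propositional variables $x\in\{\pm1\}^n$, real variables $y\in\mathbb{R}^m$; atoms $\alpha_i:\ \sum_j q_{i,j}y_j-q_{i,0}\bowtie_i0$ ($i=1,\dots,k$, $q_i\neq0$) with $\delta_i(y)=-1$ if $\alpha_i$ holds, else $+1$. $C$ is a finite set of constraints with weights $w_c>0$, $\alpha=\sum_cw_c$; $c$ is represented by $f_c(x,y)=\tilde f_c(x,\delta(y))\in\{\pm1\}$ with coefficients $\hat f_c(S,T)=\mathbb{E}_{(x,z)\text{ uniform}}[\tilde f_c(x,z)\prod_{i\in S}x_i\prod_{i\in T}z_i]$. For $\sigma>0$, $d_i(b)=\mathbb{E}_{y\sim\mathcal{N}(b,\sigma^2I)}[\delta_i(y)]$ and $\mathcal{C}_\sigma(a,b)=\sum_cw_c\sum_{S,T}\hat f_c(S,T)\prod_{i\in S}a_i\prod_{i\in T}d_i(b)$. $\mathcal{D}$ is the set of $(a,b)$ with $a\in[-1,1]^n$ and $b$ satisfying every constraint of $C$ consisting of a single atom without propositional variables. Projected gradient descent: $(a^{(t+1)},b^{(t+1)})=\mathrm{proj}_{\mathcal{D}}\big((a^{(t)},b^{(t)})-\eta\nabla\mathcal{C}_\sigma(a^{(t)},b^{(t)})\big)$,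 with projected gradient mapping $g(a,b)=\frac1\eta\big((a,b)-\mathrm{proj}_{\mathcal{D}}((a,b)-\eta\nabla\mathcal{C}_\sigma(a,b))\big)$. A point is $\epsilon$-projected-critical if $\|g(a,b)\|^2\le\epsilon^2$. $L=\sqrt{n+m\gamma^2}\,\alpha\sqrt{n+m}\max(1,\gamma)$ with $\gamma=\sqrt2\beta/(\sqrt\pi\sigma)$, $\beta$ the maximum number of atoms of a single constraint in which a given real variable has nonzero coefficient. *)

theory Defs
  imports "HOL-Analysis.Analysis" "HOL-Probability.Probability"
begin

text \<open>Truth values: -1 = True, +1 = False.
  Propositional variables are indexed by the finite type 'n, real variables by
  the finite type 'm, atoms by the finite type 'k, constraints by elements of a
  finite set of type 'c.\<close>

datatype cmp = Lt | Le | Eq | Ge | Gt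

fun cmp_holds :: "cmp \<Rightarrow> real \<Rightarrow> bool" where
  "cmp_holds Lt r = (r < 0)"
| "cmp_holds Le r = (r \<le> 0)"
| "cmp_holds Eq r = (r = 0)"
| "cmp_holds Ge r = (r \<ge> 0)"
| "cmp_holds Gt r = (r > 0)"

definition atom_holds ::
  "('k \<Rightarrow> real^'m) \<Rightarrow> ('k \<Rightarrow> real) \<Rightarrow> ('k \<Rightarrow> cmp) \<Rightarrow> 'k \<Rightarrow> real^'m \<Rightarrow> bool" where
  "atom_holds q q0 rel i y = cmp_holds (rel i) (q i \<bullet> y - q0 i)"

definition delta ::
  "('k \<Rightarrow> real^'m) \<Rightarrow> ('k \<Rightarrow> real) \<Rightarrow> ('k \<Rightarrow> cmp) \<Rightarrow> 'k \<Rightarrow> real^'m \<Rightarrow> real" where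
  "delta q q0 rel i y = (if atom_holds q q0 rel i y then -1 else 1)"

definition pm_vecs :: "('i::finite \<Rightarrow> real) set" where
  "pm_vecs = {x. \<forall>i. x i \<in> {-1, 1}}"

definition fourier_coeff ::
  "(('n::finite \<Rightarrow> real) \<Rightarrow> ('k::finite \<Rightarrow> real) \<Rightarrow> real) \<Rightarrow> 'n set \<Rightarrow> 'k set \<Rightarrow> real" where
  "fourier_coeff F S T =
     (\<Sum>x\<in>pm_vecs. \<Sum>z\<in>pm_vecs. F x z * (\<Prod>i\<in>S. x i) * (\<Prod>i\<in>T. z i))
       / (real (card (pm_vecs :: ('n \<Rightarrow> real) set)) * real (card (pm_vecs :: ('k \<Rightarrow> real) set)))"

definition smoothed_delta ::
  "real \<Rightarrow> ('k \<Rightarrow> real^'m::finite) \<Rightarrow> ('k \<Rightarrow> real) \<Rightarrow> ('k \<Rightarrow> cmp) \<Rightarrow> 'k \<Rightarrow> real^'m \<Rightarrow> real" where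
  "smoothed_delta \<sigma> q q0 rel i b =
     (LINT y|lborel. delta q q0 rel i y * (\<Prod>j\<in>UNIV. normal_density (b $ j) \<sigma> (y $ j)))"

definition Csigma ::
  "real \<Rightarrow> 'c set \<Rightarrow> ('c \<Rightarrow> real) \<Rightarrow> ('c \<Rightarrow> ('n::finite \<Rightarrow> real) \<Rightarrow> ('k::finite \<Rightarrow> real) \<Rightarrow> real)
   \<Rightarrow> ('k \<Rightarrow> real^'m::finite) \<Rightarrow> ('k \<Rightarrow> real) \<Rightarrow> ('k \<Rightarrow> cmp) \<Rightarrow> (real^'n) \<times> (real^'m) \<Rightarrow> real" where
  "Csigma \<sigma> Cs w F q q0 rel p =
     (\<Sum>c\<in>Cs. w c * (\<Sum>S\<in>Pow UNIV. \<Sum>T\<in>Pow UNIV.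
        fourier_coeff (F c) S T * (\<Prod>i\<in>S. fst p $ i) * (\<Prod>i\<in>T. smoothed_delta \<sigma> q q0 rel i (snd p))))"

text \<open>Constraint c (with atom set atm c and Boolean representation F c) consists of
  the single atom i and no propositional variables.\<close>
definition single_atom ::
  "(('n::finite \<Rightarrow> real) \<Rightarrow> ('k::finite \<Rightarrow> real) \<Rightarrow> real) \<Rightarrow> 'k set \<Rightarrow> 'k \<Rightarrow> bool" where
  "single_atom Fc A i \<longleftrightarrow> A = {i} \<and> (\<forall>x\<in>pm_vecs. \<forall>z\<in>pm_vecs. Fc x z = z i)"

definition Dom ::
  "'c set \<Rightarrow> ('c \<Rightarrow> ('n::finite \<Rightarrow> real) \<Rightarrow> ('k::finite \<Rightarrow> real) \<Rightarrow> real) \<Rightarrow> ('c \<Rightarrow> 'k set)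
   \<Rightarrow> ('k \<Rightarrow> real^'m::finite) \<Rightarrow> ('k \<Rightarrow> real) \<Rightarrow> ('k \<Rightarrow> cmp) \<Rightarrow> ((real^'n) \<times> (real^'m)) set" where
  "Dom Cs F atm q q0 rel =
     {p. (\<forall>i. fst p $ i \<in> {-1..1}) \<and>
         (\<forall>c\<in>Cs. \<forall>i. single_atom (F c) (atm c) i \<longrightarrow> atom_holds q q0 rel i (snd p))}"

text \<open>Gradient and Euclidean projection (onto the closure of the set, which is the
  set itself whenever the set is closed).\<close>
definition grad :: "('a::real_inner \<Rightarrow> real) \<Rightarrow> 'a \<Rightarrow> 'a" where
  "grad f p = (THE G. GDERIV f p :> G)"

definition proj :: "('a::euclidean_space) set \<Rightarrow> 'a \<Rightarrow> 'a" where
  "proj S x = closest_point (closure S) x"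

definition pgd_step :: "real \<Rightarrow> ('a::euclidean_space \<Rightarrow> real) \<Rightarrow> 'a set \<Rightarrow> 'a \<Rightarrow> 'a" where
  "pgd_step \<eta> f S p = proj S (p - \<eta> *\<^sub>R grad f p)"

definition grad_map :: "real \<Rightarrow> ('a::euclidean_space \<Rightarrow> real) \<Rightarrow> 'a set \<Rightarrow> 'a \<Rightarrow> 'a" where
  "grad_map \<eta> f S p = (1 / \<eta>) *\<^sub>R (p - proj S (p - \<eta> *\<^sub>R grad f p))"

definition beta :: "'c set \<Rightarrow> ('c \<Rightarrow> 'k::finite set) \<Rightarrow> ('k \<Rightarrow> real^'m::finite) \<Rightarrow> nat" where
  "beta Cs atm q = Max ({0} \<union> {card {i\<in>atm c. q i $ j \<noteq> 0} | c j. c \<in> Cs})"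

definition Lconst :: "nat \<Rightarrow> nat \<Rightarrow> real \<Rightarrow> real \<Rightarrow> nat \<Rightarrow> real" where
  "Lconst n m \<alpha> \<sigma> \<beta> =
     (let \<gamma> = sqrt 2 * real \<beta> / (sqrt pi * \<sigma>)
      in sqrt (real n + real m * \<gamma>\<^sup>2) * \<alpha> * sqrt (real n + real m) * max 1 \<gamma>)"

end

theory Submission
  imports Defs
begin

text \<open>Expanding the Fourier sum turns \<^term>\<open>Csigma\<close> into a weighted sum of multilinear extensions,
  evaluated at \<open>a\<close> and at the smoothed atoms. The law of \<open>q i \<bullet> y\<close> is a one-dimensional
  Gaussian, so each smoothed atom is an affine function of a normal distribution function of
  \<open>q i \<bullet> b\<close>; its first derivative is at most \<open>\<kappa> / norm (q i)\<close> with
  \<open>\<kappa> = sqrt 2 / (sqrt pi * \<sigma>)\<close>, and its second derivative is at most the square of that.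
  Along a segment with direction \<open>(u, v)\<close> the second derivative of each extension is
  therefore at most \<open>((\<Sum>i. \<bar>u i\<bar>) + \<gamma> * (\<Sum>j. \<bar>v j\<bar>))\<^sup>2\<close>, which Cauchy--Schwarz bounds by
  \<open>(n + m * \<gamma>\<^sup>2) * (norm (u, v))\<^sup>2\<close>. Taylor's theorem gives the quadratic upper bound with
  constant \<open>L\<close>, each step of projected gradient descent then lowers the objective by at least
  \<open>(norm g)\<^sup>2 / (2 * L)\<close>, and the objective ranges over \<open>[-\<alpha>, \<alpha>]\<close>.\<close>

subsection \<open>Projected gradient descent\<close>

text \<open>The obtuse-angle property of the projection, tested at \<open>p\<close>, gives \<open>L
  * (norm (p - p'))\<^sup>2 \<le> grad f p \<bullet> (p - p')\<close>. Inserted into the quadratic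
  upper bound, this leaves a decrease of \<open>L / 2 * (norm (p - p'))\<^sup>2\<close>. Smoothness
  is asked for on the closure because \<open>proj\<close> projects there.\<close>

lemma pgd_step_descent:
  fixes f :: "'a::euclidean_space \<Rightarrow> real"
  assumes "convex S" "L > 0" "p \<in> closure S"
    and smooth: "\<And>p p'. p \<in> closure S \<Longrightarrow> p' \<in> closure S \<Longrightarrow>
      f p' \<le> f p + grad f p \<bullet> (p' - p) + L / 2 * (norm (p' - p))\<^sup>2"
  shows "pgd_step (1 / L) f S p \<in> closure S"
    and "(norm (grad_map (1 / L) f S p))\<^sup>2 \<le> 2 * L * (f p - f (pgd_step (1 / L) f S p))"
proof -
  define p' where "p' = pgd_step (1 / L) f S p"
  have p'_eq: "p' = closest_point (closure S) (p - (1 / L) *\<^sub>R grad f p)"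
    by (simp add: p'_def pgd_step_def proj_def)
  show p': "pgd_step (1 / L) f S p \<in> closure S"
    unfolding pgd_step_def proj_def using assms(3) by (intro closest_point_in_set) auto
  have "(p - (1 / L) *\<^sub>R grad f p - p') \<bullet> (p - p') \<le> 0"
    unfolding p'_eq using assms by (intro closest_point_dot) auto
  then have "(norm (p - p'))\<^sup>2 \<le> (1 / L) * (grad f p \<bullet> (p - p'))"
    by (simp add: power2_norm_eq_inner algebra_simps)
  then have "L * (norm (p - p'))\<^sup>2 \<le> grad f p \<bullet> (p - p')"
    using \<open>L > 0\<close> by (simp add: field_simps)
  moreover have "f p' \<le> f p - grad f p \<bullet> (p - p') + L / 2 * (norm (p - p'))\<^sup>2"
    using smooth[OF assms(3) p'] by (simp add: p'_def[symmetric] norm_minus_commute inner_diff_right)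
  ultimately have "L / 2 * (norm (p - p'))\<^sup>2 \<le> f p - f p'" by simp
  then have "2 * L * (L / 2 * (norm (p - p'))\<^sup>2) \<le> 2 * L * (f p - f p')"
    using \<open>L > 0\<close> by (intro mult_left_mono) auto
  moreover have "grad_map (1 / L) f S p = L *\<^sub>R (p - p')"
    by (simp add: grad_map_def p'_def pgd_step_def)
  ultimately show "(norm (grad_map (1 / L) f S p))\<^sup>2 \<le> 2 * L * (f p - f (pgd_step (1 / L) f S p))"
    by (simp add: p'_def[symmetric] power_mult_distrib power2_eq_square mult_ac)
qed

text \<open>If no iterate up to the bound were critical, each step would lower \<open>f\<close> by
  more than \<open>\<epsilon>\<^sup>2 / (2 * L)\<close>, while the telescoped total decrease is at
  most \<open>2 * B\<close>.\<close>

lemma pgd_reaches_critical: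
  fixes f :: "'a::euclidean_space \<Rightarrow> real"
  assumes "convex S" "L > 0" "p0 \<in> S" "\<epsilon> > 0"
    and bound: "\<And>p. p \<in> closure S \<Longrightarrow> \<bar>f p\<bar> \<le> B"
    and smooth: "\<And>p p'. p \<in> closure S \<Longrightarrow> p' \<in> closure S \<Longrightarrow>
      f p' \<le> f p + grad f p \<bullet> (p' - p) + L / 2 * (norm (p' - p))\<^sup>2"
  shows "\<exists>t::nat. real t \<le> 4 * B * L / \<epsilon>\<^sup>2 \<and>
    (norm (grad_map (1 / L) f S ((pgd_step (1 / L) f S ^^ t) p0)))\<^sup>2 \<le> \<epsilon>\<^sup>2"
proof (rule ccontr)
  assume none: "\<not> ?thesis"
  define x where "x t = (pgd_step (1 / L) f S ^^ t) p0" for t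
  define T where "T = nat \<lfloor>4 * B * L / \<epsilon>\<^sup>2\<rfloor>"
  have x_in: "x t \<in> closure S" for t
  proof (induction t)
    case 0 show ?case using assms(3) closure_subset by (auto simp: x_def)
  next
    case (Suc t) then show ?case
      using pgd_step_descent(1)[OF assms(1,2) _ smooth] by (simp add: x_def)
  qed
  \<comment> \<open>Nonnegativity of the bound keeps \<open>nat\<close> from truncating in
    \<open>T\<close>.\<close>
  have "B \<ge> 0" using bound[OF x_in[of 0]] by simp
  then have nonneg: "4 * B * L / \<epsilon>\<^sup>2 \<ge> 0" using \<open>L > 0\<close> by simp
  have big: "\<epsilon>\<^sup>2 < 2 * L * (f (x t) - f (x (Suc t)))" if "t < Suc T" for t
  proof -
    have "real t \<le> 4 * B * L / \<epsilon>\<^sup>2" using that nonneg unfolding T_def by linarith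
    then have "\<epsilon>\<^sup>2 < (norm (grad_map (1 / L) f S (x t)))\<^sup>2" using none unfolding x_def by (meson not_le)
    also have "\<dots> \<le> 2 * L * (f (x t) - f (x (Suc t)))"
      using pgd_step_descent(2)[OF assms(1,2) x_in smooth] by (simp add: x_def)
    finally show ?thesis .
  qed
  \<comment> \<open>The iterates \<open>0, ..., T\<close> give \<open>T + 1\<close> decreases, one
    more than the floor of the bound; this surplus is the contradiction, so the weak inequality
    suffices below.\<close>
  have "real (Suc T) * \<epsilon>\<^sup>2 = (\<Sum>t<Suc T. \<epsilon>\<^sup>2)" by simp
  also have "\<dots> \<le> (\<Sum>t<Suc T. 2 * L * (f (x t) - f (x (Suc t))))"
    using big by (intro sum_mono less_imp_le) auto
  also have "\<dots> = 2 * L * (f (x 0) - f (x (Suc T)))"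
    by (simp only: sum_distrib_left[symmetric] sum_lessThan_telescope'[of "\<lambda>t. f (x t)"])
  also have "\<dots> \<le> 2 * L * (2 * B)"
    using bound[OF x_in[of 0]] bound[OF x_in[of "Suc T"]] \<open>L > 0\<close> by (intro mult_left_mono) auto
  finally have "real (Suc T) \<le> 4 * B * L / \<epsilon>\<^sup>2"
    using \<open>\<epsilon> > 0\<close> by (simp add: field_simps)
  then show False using nonneg unfolding T_def by linarith
qed

subsection \<open>Multilinear extensions\<close>

lemma finite_pm_vecs [simp]: "finite (pm_vecs :: ('i::finite \<Rightarrow> real) set)"
proof -
  have "pm_vecs = PiE (UNIV :: 'i set) (\<lambda>_. {-1, 1 :: real})"
    by (auto simp: pm_vecs_def PiE_def)
  then show ?thesis using finite_PiE[of "UNIV :: 'i set" "\<lambda>_. {-1, 1 :: real}"] by simp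
qed

lemma sum_pm_vecs_prod:
  fixes g :: "'i::finite \<Rightarrow> real \<Rightarrow> real"
  shows "(\<Sum>s\<in>pm_vecs. \<Prod>i\<in>UNIV. g i (s i)) = (\<Prod>i\<in>UNIV. g i (-1) + g i 1)"
proof -
  have "pm_vecs = PiE (UNIV :: 'i set) (\<lambda>_. {-1, 1 :: real})"
    by (auto simp: pm_vecs_def PiE_def)
  then show ?thesis
    using prod_sum_PiE[of "UNIV :: 'i set" "\<lambda>_. {-1, 1 :: real}" g] by simp
qed

lemma card_pm_vecs: "real (card (pm_vecs :: ('i::finite \<Rightarrow> real) set)) = 2 ^ CARD('i)"
  using sum_pm_vecs_prod[of "\<lambda>(_::'i) _. 1"] by simp

text \<open>The multilinear extension of \<open>G\<close>: its value at \<open>e\<close> is the mean of \<open>G\<close>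
  over independent random signs with means \<open>e i\<close>.\<close>
definition mlext :: "(('i::finite \<Rightarrow> real) \<Rightarrow> real) \<Rightarrow> ('i \<Rightarrow> real) \<Rightarrow> real" where
  "mlext G e = (\<Sum>s\<in>pm_vecs. G s * (\<Prod>i\<in>UNIV. (1 + s i * e i) / 2))"

text \<open>After the triangle inequality the sum over sign vectors factorises over the coordinates.
  The values of a multilinear extension and the entries of its Hessian all have this shape, with
  different factors \<open>g\<close>.\<close>

lemma abs_weighted_sum_le:
  fixes g :: "'i::finite \<Rightarrow> real \<Rightarrow> real"
  assumes "\<And>s. s \<in> pm_vecs \<Longrightarrow> \<bar>G s\<bar> \<le> 1"
  shows "\<bar>\<Sum>s\<in>pm_vecs. G s * (\<Prod>i\<in>UNIV. g i (s i))\<bar> \<le> (\<Prod>i\<in>UNIV. \<bar>g i (-1)\<bar> + \<bar>g i 1\<bar>)"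
proof -
  have "\<bar>\<Sum>s\<in>pm_vecs. G s * (\<Prod>i\<in>UNIV. g i (s i))\<bar> \<le> (\<Sum>s\<in>pm_vecs. \<bar>G s * (\<Prod>i\<in>UNIV. g i (s i))\<bar>)"
    by (rule sum_abs)
  also have "\<dots> \<le> (\<Sum>s\<in>pm_vecs. \<Prod>i\<in>UNIV. \<bar>g i (s i)\<bar>)"
    using assms by (intro sum_mono) (auto simp: abs_mult abs_prod intro!: mult_left_le_one_le prod_nonneg)
  also have "\<dots> = (\<Prod>i\<in>UNIV. \<bar>g i (-1)\<bar> + \<bar>g i 1\<bar>)" by (rule sum_pm_vecs_prod)
  finally show ?thesis .
qed

text \<open>On the cube the two factors belonging to a coordinate are the probabilities of its two
  signs, so they are nonnegative and add up to 1.\<close>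

lemma abs_mlext_le_1:
  assumes "\<And>s. s \<in> pm_vecs \<Longrightarrow> \<bar>G s\<bar> \<le> 1" "\<And>i. \<bar>e i\<bar> \<le> 1"
  shows "\<bar>mlext G e\<bar> \<le> 1"
proof -
  have "\<bar>1 + - 1 * e i\<bar> + \<bar>1 + 1 * e i\<bar> = 2" for i
    using assms(2)[of i] by (auto simp: abs_if split: if_splits)
  then have "\<bar>(1 + - 1 * e i) / 2\<bar> + \<bar>(1 + 1 * e i) / 2\<bar> = 1" for i by (simp add: add_divide_distrib[symmetric])
  then show ?thesis unfolding mlext_def
    using abs_weighted_sum_le[OF assms(1), where g = "\<lambda>i s. (1 + s * e i) / 2"] by simp
qed

text \<open>Each entry of the Hessian of \<^term>\<open>mlext G\<close> off the diagonal is at most 1 on the cube and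
  the diagonal vanishes, so the diagonal terms of the square absorb the second derivatives of the
  curve.\<close>
lemma mlext_curve_derivs:
  fixes e e1 e2 :: "'i::finite \<Rightarrow> real \<Rightarrow> real"
  assumes G: "\<And>s. s \<in> pm_vecs \<Longrightarrow> \<bar>G s\<bar> \<le> 1"
    and e1: "\<And>i t. (e i has_real_derivative e1 i t) (at t)"
    and e2: "\<And>i t. (e1 i has_real_derivative e2 i t) (at t)"
    and b1: "\<And>i t. \<bar>e1 i t\<bar> \<le> u i"
    and b2: "\<And>i t. \<bar>e2 i t\<bar> \<le> (u i)\<^sup>2"
  shows "\<exists>m1 m2. (\<forall>t. ((\<lambda>t. mlext G (\<lambda>i. e i t)) has_real_derivative m1 t) (at t)) \<and>
    (\<forall>t. (m1 has_real_derivative m2 t) (at t)) \<and>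
    (\<forall>t. (\<forall>i. \<bar>e i t\<bar> \<le> 1) \<longrightarrow> \<bar>m2 t\<bar> \<le> (\<Sum>i\<in>UNIV. u i)\<^sup>2)"
proof -
  define P where "P s i t = (1 + s i * e i t) / 2" for s i t
  define P1 where "P1 s i t = s i * e1 i t / 2" for s i t
  define P2 where "P2 s i t = s i * e2 i t / 2" for s i t
  have dP: "(P s i has_real_derivative P1 s i t) (at t)" for s i t
    unfolding P_def P1_def using e1[of i t] by (auto intro!: derivative_eq_intros)
  have dP1: "(P1 s i has_real_derivative P2 s i t) (at t)" for s i t
    unfolding P1_def P2_def using e2[of i t] by (auto intro!: derivative_eq_intros)
  define m1 where "m1 t = (\<Sum>s\<in>pm_vecs. G s * (\<Sum>i\<in>UNIV. P1 s i t * (\<Prod>j\<in>UNIV - {i}. P s j t)))" for t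
  \<comment> \<open>Second derivative by the product rule: \<open>A\<close> collects the terms where
    the factor \<open>i\<close> is differentiated twice, \<open>B\<close> those where two distinct
    factors \<open>i\<close> and \<open>j\<close> are differentiated once each.\<close>
  define A where "A s t i = P2 s i t * (\<Prod>j\<in>UNIV - {i}. P s j t)" for s t i
  define B where "B s t i j = P1 s i t * (P1 s j t * (\<Prod>l\<in>UNIV - {i} - {j}. P s l t))" for s t i j
  define m2 where "m2 t = (\<Sum>s\<in>pm_vecs. G s * (\<Sum>i\<in>UNIV. A s t i + (\<Sum>j\<in>UNIV - {i}. B s t i j)))" for t
  have "((\<lambda>t. mlext G (\<lambda>i. e i t)) has_real_derivative m1 t) (at t)" for t
    unfolding mlext_def m1_def P_def[symmetric]
    by (intro DERIV_sum DERIV_cmult has_field_derivative_prod dP)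
  moreover have "(m1 has_real_derivative m2 t) (at t)" for t
  proof -
    have "((\<lambda>t. P1 s i t * (\<Prod>j\<in>UNIV - {i}. P s j t)) has_real_derivative
        A s t i + (\<Sum>j\<in>UNIV - {i}. B s t i j)) (at t)" for s i
      by (rule DERIV_cong[OF DERIV_mult[OF dP1 has_field_derivative_prod[OF dP]]])
        (simp add: A_def B_def sum_distrib_left mult_ac)
    then show ?thesis unfolding m1_def[abs_def] m2_def by (intro DERIV_sum DERIV_cmult)
  qed
  moreover have "\<bar>m2 t\<bar> \<le> (\<Sum>i\<in>UNIV. u i)\<^sup>2" if e: "\<forall>i. \<bar>e i t\<bar> \<le> 1" for t
  proof -
    have u0: "u i \<ge> 0" for i using b1[of i t] by linarith
    have one: "\<bar>(1 - e i t) / 2\<bar> + \<bar>(1 + e i t) / 2\<bar> = 1" for i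
      using e[rule_format, of i] by (auto simp: abs_if field_simps split: if_splits)
    \<comment> \<open>Only the factor at \<open>i\<close> is altered: it contributes
      \<open>\<bar>e2 i t\<bar>\<close> to the factorised bound, and every other coordinate
      contributes 1 by \<open>one\<close>.\<close>
    have bA: "\<bar>\<Sum>s\<in>pm_vecs. G s * A s t i\<bar> \<le> (u i)\<^sup>2" for i
    proof -
      define g where "g j x = (if j = i then x * e2 i t / 2 else (1 + x * e j t) / 2)" for j x
      have "A s t i = (\<Prod>j\<in>UNIV. g j (s j))" for s
        by (subst prod.remove[of _ i]) (auto simp: A_def P_def P2_def g_def intro!: prod.cong)
      then have "\<bar>\<Sum>s\<in>pm_vecs. G s * A s t i\<bar> \<le> (\<Prod>j\<in>UNIV. \<bar>g j (-1)\<bar> + \<bar>g j 1\<bar>)"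
        using abs_weighted_sum_le[OF G, where g = g] by simp
      also have "\<dots> = \<bar>e2 i t\<bar>"
        by (subst prod.remove[of _ i]) (auto simp: g_def one[simplified] intro!: prod.neutral)
      finally show ?thesis using b2[of i t] by linarith
    qed
    \<comment> \<open>As before, with the two altered factors contributing
      \<open>\<bar>e1 i t\<bar>\<close> and \<open>\<bar>e1 j t\<bar>\<close>.\<close>
    have bB: "\<bar>\<Sum>s\<in>pm_vecs. G s * B s t i j\<bar> \<le> u i * u j" if "j \<noteq> i" for i j
    proof -
      define g where "g k x = (if k = i then x * e1 i t / 2 else
        if k = j then x * e1 j t / 2 else (1 + x * e k t) / 2)" for k x
      have "B s t i j = (\<Prod>k\<in>UNIV. g k (s k))" for s
        using that by (subst prod.remove[of _ i], simp_all, subst prod.remove[of _ j])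
          (auto simp: B_def P_def P1_def g_def intro!: prod.cong)
      then have "\<bar>\<Sum>s\<in>pm_vecs. G s * B s t i j\<bar> \<le> (\<Prod>k\<in>UNIV. \<bar>g k (-1)\<bar> + \<bar>g k 1\<bar>)"
        using abs_weighted_sum_le[OF G, where g = g] by simp
      also have "\<dots> = \<bar>e1 i t\<bar> * \<bar>e1 j t\<bar>"
        using that by (subst prod.remove[of _ i], simp_all, subst prod.remove[of _ j])
          (auto simp: g_def one[simplified] intro!: prod.neutral)
      also have "\<dots> \<le> u i * u j" using b1 u0 by (intro mult_mono) auto
      finally show ?thesis .
    qed
    have "m2 t = (\<Sum>i\<in>UNIV. (\<Sum>s\<in>pm_vecs. G s * A s t i) + (\<Sum>j\<in>UNIV - {i}. \<Sum>s\<in>pm_vecs. G s * B s t i j))"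
      unfolding m2_def sum_distrib_left
      by (subst sum.swap) (simp add: sum.distrib distrib_left sum_distrib_left sum.swap[of _ pm_vecs])
    also have "\<bar>\<dots>\<bar> \<le> (\<Sum>i\<in>UNIV. (u i)\<^sup>2 + (\<Sum>j\<in>UNIV - {i}. u i * u j))"
    proof (rule order_trans[OF sum_abs], rule sum_mono, rule order_trans[OF abs_triangle_ineq], rule add_mono[OF bA])
      show "\<bar>\<Sum>j\<in>UNIV - {i}. \<Sum>s\<in>pm_vecs. G s * B s t i j\<bar> \<le> (\<Sum>j\<in>UNIV - {i}. u i * u j)" for i
        by (rule order_trans[OF sum_abs], rule sum_mono, rule bB) auto
    qed
    \<comment> \<open>The squares are exactly the missing diagonal terms of the double sum.\<close>
    also have "\<dots> = (\<Sum>i\<in>UNIV. \<Sum>j\<in>UNIV. u i * u j)"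
      by (intro sum.cong refl) (subst (2) sum.remove, auto simp: power2_eq_square)
    also have "\<dots> = (\<Sum>i\<in>UNIV. u i)\<^sup>2"
      by (simp add: power2_eq_square sum_product)
    finally show ?thesis .
  qed
  ultimately show ?thesis by blast
qed

subsection \<open>Gaussian smoothing of a half-space\<close>

lemma measurable_vec_lambda [measurable]:
  "(\<lambda>f. \<chi> j. f j) \<in> measurable (Pi\<^sub>M UNIV (\<lambda>_::'m::finite. lborel)) (borel :: (real^'m) measure)"
  by (rule borel_measurable_euclidean_space[THEN iffD2]) (auto simp: Basis_vec_def inner_axis)

text \<open>Both measures give a box the product of its side lengths, which determines Lebesgue
  measure. This moves integrals to a product space, where the coordinates can be treated as
  independent random variables.\<close>

lemma lborel_vec_eq:
  "(lborel :: (real^'m::finite) measure) = distr (Pi\<^sub>M UNIV (\<lambda>_::'m. lborel)) borel (\<lambda>f. \<chi> j. f j)"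
proof (rule lborel_eqI)
  interpret product_sigma_finite "\<lambda>_::'m. lborel :: real measure" by standard
  fix l u :: "real^'m" assume le: "\<And>b. b \<in> Basis \<Longrightarrow> l \<bullet> b \<le> u \<bullet> b"
  then have le': "l $ j \<le> u $ j" for j using le[of "axis j 1"] by (auto simp: inner_axis Basis_vec_def)
  have "(\<lambda>f. \<chi> j. f j) -` box l u \<inter> space (Pi\<^sub>M UNIV (\<lambda>_::'m. lborel :: real measure)) =
    PiE UNIV (\<lambda>j. {l $ j <..< u $ j})"
    by (auto simp: space_PiM mem_box_cart PiE_def Pi_iff)
  then have "emeasure (distr (Pi\<^sub>M UNIV (\<lambda>_::'m. lborel)) borel (\<lambda>f. \<chi> j. f j)) (box l u) =
    (\<Prod>j\<in>UNIV. ennreal (u $ j - l $ j))"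
    using le' by (simp add: emeasure_distr emeasure_PiM)
  also have "\<dots> = ennreal (\<Prod>j\<in>UNIV. u $ j - l $ j)"
    using le' by (intro prod_ennreal) auto
  also have "(\<Prod>j\<in>UNIV. u $ j - l $ j) = (\<Prod>b\<in>Basis. (u - l) \<bullet> b)"
  proof -
    have B: "(Basis :: (real^'m) set) = range (\<lambda>j. axis j 1)" by (auto simp: Basis_vec_def)
    show ?thesis unfolding B by (subst prod.reindex) (auto simp: inj_on_def axis_eq_axis inner_axis)
  qed
  finally show "emeasure (distr (Pi\<^sub>M UNIV (\<lambda>_::'m. lborel)) borel (\<lambda>f. \<chi> j. f j)) (box l u) =
    (\<Prod>b\<in>Basis. (u - l) \<bullet> b)" .
qed simp

text \<open>On rectangles the integral of a product is the product of the integrals, and a product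
  of probability measures is determined by its values on rectangles.\<close>

lemma PiM_density_lborel:
  fixes g :: "'m::finite \<Rightarrow> real \<Rightarrow> real"
  assumes [measurable]: "\<And>j. g j \<in> borel_measurable borel" and nn: "\<And>j x. g j x \<ge> 0"
    and prob: "\<And>j. prob_space (density lborel (g j))"
  shows "density (Pi\<^sub>M UNIV (\<lambda>_. lborel)) (\<lambda>f. \<Prod>j\<in>UNIV. g j (f j)) = Pi\<^sub>M UNIV (\<lambda>j. density lborel (g j))"
proof -
  interpret L: product_sigma_finite "\<lambda>_::'m. lborel :: real measure" by standard
  interpret P: product_prob_space "\<lambda>j. density lborel (g j)"
    by (intro product_prob_spaceI prob)
  show ?thesis
  proof (rule P.PiM_eqI)
    show "sets (density (Pi\<^sub>M UNIV (\<lambda>_. lborel)) (\<lambda>f. \<Prod>j\<in>UNIV. g j (f j))) =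
      sets (Pi\<^sub>M UNIV (\<lambda>j. density lborel (g j)))"
      by (simp, intro sets_PiM_cong) auto
    fix A :: "'m \<Rightarrow> real set" assume "\<And>j. j \<in> UNIV \<Longrightarrow> A j \<in> sets (density lborel (g j))"
    then have A[measurable]: "A j \<in> sets borel" for j by simp
    have "emeasure (density (Pi\<^sub>M UNIV (\<lambda>_. lborel)) (\<lambda>f. \<Prod>j\<in>UNIV. g j (f j))) (PiE UNIV A) =
      (\<integral>\<^sup>+ f. ennreal (\<Prod>j\<in>UNIV. g j (f j)) * indicator (PiE UNIV A) f \<partial>Pi\<^sub>M UNIV (\<lambda>_. lborel))"
      by (intro emeasure_density sets_PiM_I_finite) auto
    also have "\<dots> = (\<integral>\<^sup>+ f. (\<Prod>j\<in>UNIV. ennreal (g j (f j)) * indicator (A j) (f j)) \<partial>Pi\<^sub>M UNIV (\<lambda>_. lborel))"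
      by (intro nn_integral_cong)
        (auto simp: prod.distrib prod_ennreal nn indicator_def PiE_iff split: if_splits)
    also have "\<dots> = (\<Prod>j\<in>UNIV. \<integral>\<^sup>+ x. ennreal (g j x) * indicator (A j) x \<partial>lborel)"
      by (intro L.product_nn_integral_prod) auto
    also have "\<dots> = (\<Prod>j\<in>UNIV. emeasure (density lborel (g j)) (A j))"
      by (intro prod.cong refl emeasure_density[symmetric]) auto
    finally show "emeasure (density (Pi\<^sub>M UNIV (\<lambda>_. lborel)) (\<lambda>f. \<Prod>j\<in>UNIV. g j (f j))) (PiE UNIV A) =
      (\<Prod>j\<in>UNIV. emeasure (density lborel (g j)) (A j))" .
  qed auto
qed

text \<open>A sum of independent normal variables is normal; means and variances add up to
  \<open>q \<bullet> b\<close> and \<open>(\<sigma> * norm q)\<^sup>2\<close>.\<close>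

lemma distributed_linear_form_normal:
  fixes q b :: "real^'m::finite"
  assumes "q \<noteq> 0" "\<sigma> > 0"
  shows "distributed (Pi\<^sub>M UNIV (\<lambda>j. density lborel (normal_density (b $ j) \<sigma>))) lborel
    (\<lambda>f. q \<bullet> (\<chi> j. f j)) (normal_density (q \<bullet> b) (\<sigma> * norm q))"
proof -
  define N where "N = Pi\<^sub>M UNIV (\<lambda>j. density lborel (normal_density (b $ j) \<sigma>))"
  interpret P: product_prob_space "\<lambda>j. density lborel (normal_density (b $ j) \<sigma>)"
    by (intro product_prob_spaceI prob_space_normal_density assms)
  interpret N: prob_space N unfolding N_def by (intro prob_space_PiM prob_space_normal_density assms)
  have comp: "distr N borel (\<lambda>f. f j) = density lborel (normal_density (b $ j) \<sigma>)" for j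
  proof -
    have "distr N borel (\<lambda>f. f j) = distr N (density lborel (normal_density (b $ j) \<sigma>)) (\<lambda>f. f j)"
      by (rule distr_cong) auto
    also have "\<dots> = density lborel (normal_density (b $ j) \<sigma>)"
      unfolding N_def using assms by (intro distr_PiM_component prob_space_normal_density) auto
    finally show ?thesis .
  qed
  have rv: "(\<lambda>f. f j) \<in> borel_measurable N" for j
    unfolding N_def using measurable_component_singleton[of j UNIV "\<lambda>j. density lborel (normal_density (b $ j) \<sigma>)"]
    by simp
  \<comment> \<open>Independence amounts to the joint law being the product of the marginals; the
    joint law of the coordinate maps is \<open>N\<close> itself.\<close>
  have indep: "N.indep_vars (\<lambda>_. borel) (\<lambda>j f. f j) UNIV"
  proof (subst N.indep_vars_iff_distr_eq_PiM')
    have "distr N (Pi\<^sub>M UNIV (\<lambda>_. borel)) (\<lambda>f. \<lambda>j\<in>UNIV. f j) = distr N N (\<lambda>f. f)"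
      by (intro distr_cong refl) (auto simp: N_def intro!: sets_PiM_cong)
    then show "distr N (Pi\<^sub>M UNIV (\<lambda>_. borel)) (\<lambda>f. \<lambda>j\<in>UNIV. f j) = (\<Pi>\<^sub>M j\<in>UNIV. distr N borel (\<lambda>f. f j))"
      by (simp add: comp) (simp add: N_def)
  qed (auto intro: rv)
  \<comment> \<open>A zero coefficient would give a degenerate normal variable of variance 0, so
    those coordinates are dropped; \<open>q \<noteq> 0\<close> leaves at least one.\<close>
  define I where "I = {j. q $ j \<noteq> 0}"
  have I: "finite I" "I \<noteq> {}" using assms(1) by (auto simp: I_def vec_eq_iff)
  have "N.indep_vars (\<lambda>_. borel) (\<lambda>j f. q $ j * f j) I"
    using N.indep_vars_compose2[OF N.indep_vars_subset[OF indep subset_UNIV], of I "\<lambda>j x. q $ j * x" "\<lambda>_. borel"]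
    by simp
  moreover have "distributed N lborel (\<lambda>f. q $ j * f j) (normal_density (q $ j * b $ j) (\<bar>q $ j\<bar> * \<sigma>))"
    if "j \<in> I" for j
  proof -
    have "distributed N lborel (\<lambda>f. f j) (normal_density (b $ j) \<sigma>)"
      unfolding distributed_def using comp[of j] rv[of j]
      by (auto simp: distr_cong[of N N lborel borel])
    from N.normal_density_affine[OF this \<open>\<sigma> > 0\<close>, of "q $ j" 0] that show ?thesis
      by (simp add: I_def)
  qed
  ultimately have "distributed N lborel (\<lambda>f. \<Sum>j\<in>I. q $ j * f j)
    (normal_density (\<Sum>j\<in>I. q $ j * b $ j) (sqrt (\<Sum>j\<in>I. (\<bar>q $ j\<bar> * \<sigma>)\<^sup>2)))"
    using I \<open>\<sigma> > 0\<close> by (intro N.sum_indep_normal) (auto simp: I_def)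
  moreover have "(\<Sum>j\<in>I. q $ j * f j) = q \<bullet> (\<chi> j. f j)" for f :: "'m \<Rightarrow> real"
    unfolding inner_vec_def I_def by (simp, intro sum.mono_neutral_left) auto
  moreover have "(\<Sum>j\<in>I. q $ j * b $ j) = q \<bullet> b"
    unfolding inner_vec_def I_def by (simp, intro sum.mono_neutral_left) auto
  moreover have "sqrt (\<Sum>j\<in>I. (\<bar>q $ j\<bar> * \<sigma>)\<^sup>2) = \<sigma> * norm q"
  proof -
    have "(\<Sum>j\<in>I. (\<bar>q $ j\<bar> * \<sigma>)\<^sup>2) = (\<Sum>j\<in>UNIV. (\<bar>q $ j\<bar> * \<sigma>)\<^sup>2)"
      unfolding I_def by (intro sum.mono_neutral_left) auto
    then show ?thesis using \<open>\<sigma> > 0\<close>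
      by (simp add: power_mult_distrib sum_distrib_right[symmetric] real_sqrt_mult norm_vec_def L2_set_def)
  qed
  ultimately show ?thesis by (simp add: N_def)
qed

lemma integral_gaussian_linear_form:
  fixes q b :: "real^'m::finite" and g :: "real \<Rightarrow> real"
  assumes "q \<noteq> 0" "\<sigma> > 0" and [measurable]: "g \<in> borel_measurable borel"
  shows "(LINT y|lborel. g (q \<bullet> y) * (\<Prod>j\<in>UNIV. normal_density (b $ j) \<sigma> (y $ j))) =
    (LINT x|lborel. normal_density (q \<bullet> b) (\<sigma> * norm q) x * g x)"
proof -
  let ?P = "Pi\<^sub>M UNIV (\<lambda>_::'m. lborel :: real measure)"
  have nth [measurable]: "(\<lambda>y::real^'m. y $ j) \<in> borel_measurable borel" for j
    by (intro borel_measurable_continuous_onI continuous_intros)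
  have "(LINT y|lborel. g (q \<bullet> y) * (\<Prod>j\<in>UNIV. normal_density (b $ j) \<sigma> (y $ j))) =
    (LINT f|?P. g (q \<bullet> (\<chi> j. f j)) * (\<Prod>j\<in>UNIV. normal_density (b $ j) \<sigma> (f j)))"
    by (subst lborel_vec_eq, subst integral_distr) auto
  also have "\<dots> = (LINT f|density ?P (\<lambda>f. \<Prod>j\<in>UNIV. normal_density (b $ j) \<sigma> (f j)). g (q \<bullet> (\<chi> j. f j)))"
    by (subst integral_density) (auto simp: prod_nonneg mult.commute)
  also have "\<dots> = (LINT f|Pi\<^sub>M UNIV (\<lambda>j. density lborel (normal_density (b $ j) \<sigma>)). g (q \<bullet> (\<chi> j. f j)))"
    by (subst PiM_density_lborel) (auto simp: prob_space_normal_density assms)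
  also have "\<dots> = (LINT x|lborel. normal_density (q \<bullet> b) (\<sigma> * norm q) x * g x)"
    by (rule distributed_integral[symmetric, OF distributed_linear_form_normal]) (auto simp: assms)
  finally show ?thesis .
qed

section \<open>The one-dimensional normal distribution function and its derivatives\<close>

definition gauss_cdf :: "real \<Rightarrow> real \<Rightarrow> real" where
  "gauss_cdf s x = (LINT u|lborel. normal_density 0 s u * indicator {..x} u)"

text \<open>Twice the peak of the centred normal density with standard deviation \<open>s\<close>:
  the steepest slope of a smoothed jump between -1 and 1. The constant \<open>\<gamma>\<close> of
  \<open>Lconst\<close> is \<open>gauss_rate \<sigma> * \<beta>\<close>.\<close>

definition gauss_rate :: "real \<Rightarrow> real" where
  "gauss_rate s = sqrt 2 / (sqrt pi * s)"

lemma normal_density_eq_rate: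
  "s > 0 \<Longrightarrow> normal_density 0 s u = gauss_rate s / 2 * exp (- (u\<^sup>2 / (2 * s\<^sup>2)))"
  by (simp add: normal_density_def gauss_rate_def real_sqrt_mult field_simps)

lemma integrable_normal_density_indicator:
  "s > 0 \<Longrightarrow> A \<in> sets borel \<Longrightarrow> integrable lborel (\<lambda>u. normal_density \<mu> s u * indicator A u)"
  by (rule Bochner_Integration.integrable_bound[OF integrable_normal_density[of s \<mu>]])
    (auto simp: indicator_def)

lemma gauss_cdf_bounds:
  assumes "s > 0" shows "0 \<le> gauss_cdf s x" "gauss_cdf s x \<le> 1"
proof -
  show "0 \<le> gauss_cdf s x" unfolding gauss_cdf_def by (intro integral_nonneg_AE) auto
  have "gauss_cdf s x \<le> (LINT u|lborel. normal_density 0 s u)"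
    unfolding gauss_cdf_def using assms
    by (intro integral_mono integrable_normal_density_indicator) (auto simp: indicator_def)
  then show "gauss_cdf s x \<le> 1" using assms by simp
qed

text \<open>On the interval from \<open>x - 1\<close> to \<open>x + 1\<close> the distribution
  function is a constant plus an integral of the continuous density, so the fundamental theorem of
  calculus applies.\<close>

lemma DERIV_gauss_cdf:
  assumes "s > 0"
  shows "(gauss_cdf s has_real_derivative normal_density 0 s x) (at x)"
proof -
  let ?n = "normal_density 0 s" and ?a = "x - 1" and ?b = "x + 1"
  have cont: "continuous_on A ?n" for A
    unfolding normal_density_def by (intro continuous_intros) (use assms in auto)
  have eq: "gauss_cdf s y = gauss_cdf s ?a + integral {?a..y} ?n" if "y \<in> {?a..?b}" for y
  proof -
    have "set_integrable lborel {?a..y} ?n"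
      by (intro borel_integrable_atLeastAtMost' cont)
    then have "integral {?a..y} ?n = (LINT u|lborel. ?n u * indicator {?a..y} u)"
      by (simp add: set_borel_integral_eq_integral(2)[symmetric] set_lebesgue_integral_def mult.commute)
    \<comment> \<open>The integrands differ at most at the left endpoint, a null set.\<close>
    also have "\<dots> = (LINT u|lborel. ?n u * indicator {..y} u - ?n u * indicator {..?a} u)"
    proof (rule integral_cong_AE)
      show "AE u in lborel. ?n u * indicator {?a..y} u = ?n u * indicator {..y} u - ?n u * indicator {..?a} u"
        using AE_lborel_singleton[of ?a] by eventually_elim (use that in \<open>auto simp: indicator_def\<close>)
    qed auto
    also have "\<dots> = gauss_cdf s y - gauss_cdf s ?a"
      unfolding gauss_cdf_def using assms
      by (intro Bochner_Integration.integral_diff integrable_normal_density_indicator) auto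
    finally show ?thesis by simp
  qed
  have "((\<lambda>y. integral {?a..y} ?n) has_real_derivative ?n x) (at x within {?a..?b})"
    by (rule integral_has_real_derivative[OF cont]) auto
  then have "((\<lambda>y. gauss_cdf s ?a + integral {?a..y} ?n) has_real_derivative ?n x) (at x within {?a..?b})"
    by (auto intro!: derivative_eq_intros)
  then have "(gauss_cdf s has_real_derivative ?n x) (at x within {?a..?b})"
    by (rule has_field_derivative_transform_within[where d = 1]) (auto simp: eq[symmetric])
  then show ?thesis by (simp add: at_within_Icc_at)
qed

lemma DERIV_normal_density:
  assumes "s > 0"
  shows "(normal_density 0 s has_real_derivative - (x / s\<^sup>2) * normal_density 0 s x) (at x)"
proof -
  have "((\<lambda>x. exp (- (x\<^sup>2 / (2 * s\<^sup>2)))) has_real_derivative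
      exp (- (x\<^sup>2 / (2 * s\<^sup>2))) * - (2 * x / (2 * s\<^sup>2))) (at x)"
    by (intro DERIV_fun_exp DERIV_minus DERIV_cdivide) (auto intro!: derivative_eq_intros)
  from DERIV_cmult[OF this, of "gauss_rate s / 2"] show ?thesis
    unfolding normal_density_eq_rate[OF assms, abs_def] by (simp add: mult_ac)
qed

lemma normal_density_le_rate: "s > 0 \<Longrightarrow> 2 * normal_density 0 s x \<le> gauss_rate s"
  using mult_left_le[of "exp (- (x\<^sup>2 / (2 * s\<^sup>2)))" "gauss_rate s"]
  by (simp add: normal_density_eq_rate gauss_rate_def)

text \<open>A crude bound suffices: \<open>exp (r\<^sup>2 / 2) \<ge> 1 + r\<^sup>2 / 2\<close> and
  the inequality of arithmetic and geometric means bound the square by \<open>1 / 2\<close>, which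
  is below \<open>2 / pi\<close>.\<close>

lemma abs_mult_exp_le: "\<bar>r\<bar> * exp (- (r\<^sup>2 / 2)) \<le> sqrt 2 / sqrt pi" for r :: real
proof -
  have "2 * r\<^sup>2 \<le> (1 + r\<^sup>2 / 2)\<^sup>2"
    using zero_le_power2[of "1 - r\<^sup>2 / 2"] by (simp add: power2_eq_square algebra_simps)
  also have "\<dots> \<le> (exp (r\<^sup>2 / 2))\<^sup>2"
    by (intro power_mono exp_ge_add_one_self) auto
  finally have "r\<^sup>2 * (exp (- (r\<^sup>2 / 2)))\<^sup>2 \<le> 1 / 2"
    by (simp add: exp_minus field_simps)
  also have "1 / 2 \<le> 2 / pi" using pi_less_4 by (simp add: field_simps)
  finally have "(\<bar>r\<bar> * exp (- (r\<^sup>2 / 2)))\<^sup>2 \<le> (sqrt 2 / sqrt pi)\<^sup>2"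
    by (simp add: power_mult_distrib power_divide)
  then show ?thesis by (rule power2_le_imp_le) simp
qed

text \<open>Rescaling by \<open>r = x / s\<close> reduces this to the previous bound. Having the
  square of the first-order rate on the right is what \<open>mlext_curve_derivs\<close> demands of
  second derivatives.\<close>

lemma normal_density_deriv_le_rate:
  assumes "s > 0"
  shows "2 * \<bar>x / s\<^sup>2 * normal_density 0 s x\<bar> \<le> (gauss_rate s)\<^sup>2"
proof -
  have "2 * \<bar>x / s\<^sup>2 * normal_density 0 s x\<bar> =
      gauss_rate s / s * (\<bar>x / s\<bar> * exp (- ((x / s)\<^sup>2 / 2)))"
    using assms by (simp add: normal_density_eq_rate abs_mult gauss_rate_def power2_eq_square mult_ac)
  also have "\<dots> \<le> gauss_rate s / s * (sqrt 2 / sqrt pi)"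
    using assms by (intro mult_left_mono abs_mult_exp_le) (auto simp: gauss_rate_def)
  also have "\<dots> = (gauss_rate s)\<^sup>2"
    by (simp add: gauss_rate_def power2_eq_square)
  finally show ?thesis .
qed

lemma integral_normal_density_atMost:
  "(LINT u|lborel. normal_density \<mu> s u * indicator {..c} u) = gauss_cdf s (c - \<mu>)"
proof -
  have "(LINT u|lborel. normal_density \<mu> s u * indicator {..c} u) =
    (LINT u|lborel. normal_density \<mu> s (\<mu> + u) * indicator {..c} (\<mu> + u))"
    using lborel_integral_real_affine[of 1 "\<lambda>u. normal_density \<mu> s u * indicator {..c} u" \<mu>] by simp
  also have "\<dots> = gauss_cdf s (c - \<mu>)"
    unfolding gauss_cdf_def normal_density_def
    by (intro Bochner_Integration.integral_cong refl) (auto simp: indicator_def)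
  finally show ?thesis .
qed

lemma integral_normal_density_atMost_affine:
  assumes "s > 0"
  shows "(LINT u|lborel. normal_density \<mu> s u * (a + d * indicator {..c} u)) =
    a + d * gauss_cdf s (c - \<mu>)"
proof -
  have "(LINT u|lborel. normal_density \<mu> s u * (a + d * indicator {..c} u)) =
    (LINT u|lborel. a * normal_density \<mu> s u + d * (normal_density \<mu> s u * indicator {..c} u))"
    by (intro Bochner_Integration.integral_cong refl) (simp add: algebra_simps)
  also have "\<dots> = (LINT u|lborel. a * normal_density \<mu> s u) +
    (LINT u|lborel. d * (normal_density \<mu> s u * indicator {..c} u))"
    using assms
    by (intro Bochner_Integration.integral_add integrable_mult_right
        integrable_normal_density integrable_normal_density_indicator) auto
  also have "\<dots> = a + d * gauss_cdf s (c - \<mu>)"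
    using assms by (simp add: integral_normal_density_atMost)
  finally show ?thesis .
qed

text \<open>The three values of \<open>d\<close> belong to the comparisons \<open><, \<le>\<close>, to \<open>>, \<ge>\<close>, and to
  equality, which holds on a null set only.\<close>
lemma smoothed_delta_eq:
  fixes q :: "'k \<Rightarrow> real^'m::finite"
  assumes "q i \<noteq> 0" "\<sigma> > 0"
  obtains a d where "(a, d) \<in> {(1, -2), (-1, 2), (1, 0)}"
    and "\<And>b. smoothed_delta \<sigma> q q0 rel i b = a + d * gauss_cdf (\<sigma> * norm (q i)) (q0 i - q i \<bullet> b)"
proof -
  define a :: real where "a = (if rel i \<in> {Gt, Ge} then -1 else 1)"
  define d :: real where "d = (if rel i \<in> {Gt, Ge} then 2 else if rel i = Eq then 0 else -2)"
  define g :: "real \<Rightarrow> real" where "g x = (if cmp_holds (rel i) (x - q0 i) then -1 else 1)" for x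
  let ?s = "\<sigma> * norm (q i)"
  have s: "?s > 0" using assms by simp
  have [measurable]: "g \<in> borel_measurable borel"
    unfolding g_def by (cases "rel i") simp_all
  have "smoothed_delta \<sigma> q q0 rel i b = a + d * gauss_cdf ?s (q0 i - q i \<bullet> b)" for b
  proof -
    have "smoothed_delta \<sigma> q q0 rel i b = (LINT x|lborel. normal_density (q i \<bullet> b) ?s x * g x)"
      unfolding smoothed_delta_def
      using integral_gaussian_linear_form[OF assms, of g b]
      by (simp add: delta_def atom_holds_def g_def cong: if_cong)
    also have "\<dots> = (LINT x|lborel. normal_density (q i \<bullet> b) ?s x * (a + d * indicator {..q0 i} x))"
    \<comment> \<open>Whether a comparison is strict matters only at the threshold
      \<open>q0 i\<close>, a null set.\<close>
    proof (rule integral_cong_AE)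
      show "AE x in lborel. normal_density (q i \<bullet> b) ?s x * g x =
          normal_density (q i \<bullet> b) ?s x * (a + d * indicator {..q0 i} x)"
        using AE_lborel_singleton[of "q0 i"]
        by eventually_elim (cases "rel i"; auto simp: g_def a_def d_def indicator_def)
    qed auto
    also have "\<dots> = a + d * gauss_cdf ?s (q0 i - q i \<bullet> b)"
      by (rule integral_normal_density_atMost_affine[OF s])
    finally show ?thesis .
  qed
  moreover have "(a, d) \<in> {(1, -2), (-1, 2), (1, 0)}" by (auto simp: a_def d_def)
  ultimately show thesis using that by blast
qed

text \<open>A smoothed atom depends on \<open>b\<close> only through \<open>q i \<bullet> b\<close>.
  The linear form has standard deviation \<open>\<sigma> * norm (q i)\<close>, whence the division
  by \<open>norm (q i)\<close> in the rates; the jump height \<open>\<bar>d\<bar> \<le> 2\<close> is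
  already contained in \<open>gauss_rate\<close>.\<close>

lemma smoothed_delta_profile:
  fixes q :: "'k \<Rightarrow> real^'m::finite"
  assumes "q i \<noteq> 0" "\<sigma> > 0"
  obtains h h1 h2 where "\<And>b. smoothed_delta \<sigma> q q0 rel i b = h (q i \<bullet> b)"
    and "\<And>x. \<bar>h x\<bar> \<le> 1"
    and "\<And>x. (h has_real_derivative h1 x) (at x)"
    and "\<And>x. (h1 has_real_derivative h2 x) (at x)"
    and "\<And>x. \<bar>h1 x\<bar> \<le> gauss_rate \<sigma> / norm (q i)"
    and "\<And>x. \<bar>h2 x\<bar> \<le> (gauss_rate \<sigma> / norm (q i))\<^sup>2"
proof -
  define s where "s = \<sigma> * norm (q i)"
  have s: "s > 0" using assms by (simp add: s_def)
  have rate: "gauss_rate \<sigma> / norm (q i) = gauss_rate s" by (simp add: s_def gauss_rate_def)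
  obtain a d where ad: "(a, d) \<in> {(1, -2), (-1, 2), (1, 0)}"
    and eq: "\<And>b. smoothed_delta \<sigma> q q0 rel i b = a + d * gauss_cdf s (q0 i - q i \<bullet> b)"
    using smoothed_delta_eq[of q i \<sigma> q0 rel, OF assms] unfolding s_def by metis
  have d: "\<bar>d\<bar> \<le> 2" using ad by auto
  define n where "n = normal_density 0 s"
  define h where "h x = a + d * gauss_cdf s (q0 i - x)" for x
  define h1 where "h1 x = - d * n (q0 i - x)" for x
  define h2 where "h2 x = - d * ((q0 i - x) / s\<^sup>2 * n (q0 i - x))" for x
  show thesis
  proof (rule that[of h h1 h2])
    show "smoothed_delta \<sigma> q q0 rel i b = h (q i \<bullet> b)" for b by (simp add: eq h_def)
    show "\<bar>h x\<bar> \<le> 1" for x using gauss_cdf_bounds[OF s, of "q0 i - x"] ad by (auto simp: h_def)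
    show "(h has_real_derivative h1 x) (at x)" for x
      unfolding h_def h1_def n_def
      by (auto intro!: derivative_eq_intros DERIV_chain2[OF DERIV_gauss_cdf[OF s]])
    show "(h1 has_real_derivative h2 x) (at x)" for x
      unfolding h1_def h2_def n_def
      by (auto intro!: derivative_eq_intros DERIV_chain2[OF DERIV_normal_density[OF s]])
    show "\<bar>h1 x\<bar> \<le> gauss_rate \<sigma> / norm (q i)" for x
    proof -
      have "\<bar>h1 x\<bar> \<le> 2 * n (q0 i - x)"
        using mult_right_mono[OF d, of "n (q0 i - x)"] by (simp add: h1_def n_def abs_mult)
      then show ?thesis unfolding rate n_def using normal_density_le_rate[OF s] order_trans by blast
    qed
    show "\<bar>h2 x\<bar> \<le> (gauss_rate \<sigma> / norm (q i))\<^sup>2" for x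
    proof -
      have "\<bar>h2 x\<bar> \<le> 2 * \<bar>(q0 i - x) / s\<^sup>2 * n (q0 i - x)\<bar>"
        unfolding h2_def abs_mult[of "- d"] abs_minus_cancel by (intro mult_right_mono d) simp
      then show ?thesis
        unfolding rate n_def using normal_density_deriv_le_rate[OF s] order_trans by blast
    qed
  qed
qed

subsection \<open>Fourier expansion and smoothness of the objective\<close>

lemma prod_UNIV_sum_type:
  fixes f :: "'a::finite + 'b::finite \<Rightarrow> real"
  shows "prod f UNIV = (\<Prod>i\<in>UNIV. f (Inl i)) * (\<Prod>j\<in>UNIV. f (Inr j))"
  by (simp add: prod.Plus flip: UNIV_Plus_UNIV)

lemma sum_UNIV_sum_type:
  fixes f :: "'a::finite + 'b::finite \<Rightarrow> real"
  shows "sum f UNIV = (\<Sum>i\<in>UNIV. f (Inl i)) + (\<Sum>j\<in>UNIV. f (Inr j))"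
  by (simp add: sum.Plus flip: UNIV_Plus_UNIV)

lemma pm_vecs_sum_type_iff:
  "s \<in> pm_vecs \<longleftrightarrow> (\<lambda>i. s (Inl i)) \<in> pm_vecs \<and> (\<lambda>j. s (Inr j)) \<in> pm_vecs"
  by (auto simp: pm_vecs_def split_sum_all)

lemma sum_pm_vecs_sum_type:
  fixes f :: "('a::finite + 'b::finite \<Rightarrow> real) \<Rightarrow> real"
  shows "sum f pm_vecs = (\<Sum>x\<in>pm_vecs. \<Sum>z\<in>pm_vecs. f (case_sum x z))"
  unfolding sum.cartesian_product
  by (rule sum.reindex_bij_witness[where j = "\<lambda>s. (\<lambda>i. s (Inl i), \<lambda>j. s (Inr j))"
        and i = "\<lambda>(x, z). case_sum x z"])
    (auto simp: pm_vecs_sum_type_iff surjective_sum)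

text \<open>Expansion of the product of the factors \<open>1 + x i * a i\<close> over subsets; this
  turns Fourier characters into the weights of \<open>mlext\<close>.\<close>

lemma sum_Pow_prod_eq:
  fixes x a :: "'i::finite \<Rightarrow> real"
  shows "(\<Sum>S\<in>Pow UNIV. (\<Prod>i\<in>S. x i) * (\<Prod>i\<in>S. a i)) = 2 ^ CARD('i) * (\<Prod>i\<in>UNIV. (1 + x i * a i) / 2)"
  using prod_add[of UNIV "\<lambda>i. x i * a i" "\<lambda>_. 1"]
  by (simp add: prod.distrib prod_dividef add.commute)

text \<open>Propositional variables and atoms share one index type, so that \<open>mlext\<close>
  handles mixed second derivatives uniformly.\<close>

definition join_fun :: "(('n \<Rightarrow> real) \<Rightarrow> ('k \<Rightarrow> real) \<Rightarrow> real) \<Rightarrow> ('n + 'k \<Rightarrow> real) \<Rightarrow> real" where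
  "join_fun F s = F (\<lambda>i. s (Inl i)) (\<lambda>j. s (Inr j))"

text \<open>Fourier inversion on the cube: once the coefficients are written as averages and the
  sums are exchanged, the two subset sums become products over all coordinates.\<close>

lemma fourier_expansion:
  fixes F :: "('n::finite \<Rightarrow> real) \<Rightarrow> ('k::finite \<Rightarrow> real) \<Rightarrow> real"
  shows "(\<Sum>S\<in>Pow UNIV. \<Sum>T\<in>Pow UNIV. fourier_coeff F S T * (\<Prod>i\<in>S. a i) * (\<Prod>i\<in>T. d i)) =
    mlext (join_fun F) (case_sum a d)"
proof -
  let ?N = "2 ^ CARD('n) * 2 ^ CARD('k) :: real"
  have "(\<Sum>S\<in>Pow UNIV. \<Sum>T\<in>Pow UNIV. fourier_coeff F S T * (\<Prod>i\<in>S. a i) * (\<Prod>i\<in>T. d i)) =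
    (\<Sum>S\<in>Pow UNIV. \<Sum>T\<in>Pow UNIV. \<Sum>x\<in>pm_vecs. \<Sum>z\<in>pm_vecs.
      F x z / ?N * ((\<Prod>i\<in>S. x i) * (\<Prod>i\<in>S. a i)) * ((\<Prod>i\<in>T. z i) * (\<Prod>i\<in>T. d i)))"
    by (intro sum.cong refl)
      (simp add: fourier_coeff_def card_pm_vecs sum_distrib_left sum_distrib_right sum_divide_distrib mult_ac)
  also have "\<dots> = (\<Sum>x\<in>pm_vecs. \<Sum>z\<in>pm_vecs. \<Sum>S\<in>Pow UNIV. \<Sum>T\<in>Pow UNIV.
      F x z / ?N * ((\<Prod>i\<in>S. x i) * (\<Prod>i\<in>S. a i)) * ((\<Prod>i\<in>T. z i) * (\<Prod>i\<in>T. d i)))"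
    by (simp only: sum.swap[of _ "pm_vecs :: ('n \<Rightarrow> real) set" "Pow (UNIV :: 'k set)"]
        sum.swap[of _ "pm_vecs :: ('n \<Rightarrow> real) set" "Pow (UNIV :: 'n set)"]
        sum.swap[of _ "pm_vecs :: ('k \<Rightarrow> real) set" "Pow (UNIV :: 'k set)"]
        sum.swap[of _ "pm_vecs :: ('k \<Rightarrow> real) set" "Pow (UNIV :: 'n set)"])
  also have "\<dots> = (\<Sum>x\<in>pm_vecs. \<Sum>z\<in>pm_vecs. F x z / ?N *
      ((\<Sum>S\<in>Pow UNIV. (\<Prod>i\<in>S. x i) * (\<Prod>i\<in>S. a i)) * (\<Sum>T\<in>Pow UNIV. (\<Prod>i\<in>T. z i) * (\<Prod>i\<in>T. d i))))"
    by (simp only: sum_product) (simp only: sum_distrib_left mult.assoc)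
  also have "\<dots> = (\<Sum>x\<in>pm_vecs. \<Sum>z\<in>pm_vecs. F x z *
      ((\<Prod>i\<in>UNIV. (1 + x i * a i) / 2) * (\<Prod>i\<in>UNIV. (1 + z i * d i) / 2)))"
    unfolding sum_Pow_prod_eq by (intro sum.cong refl) simp
  also have "\<dots> = mlext (join_fun F) (case_sum a d)"
    by (simp add: mlext_def join_fun_def sum_pm_vecs_sum_type prod_UNIV_sum_type)
  finally show ?thesis .
qed

text \<open>Flipping the sign of \<open>z i\<close> is an involution of the sign vectors that
  preserves \<open>F\<close> and negates the character, so the sum equals its own negative.\<close>

lemma fourier_coeff_eq_0:
  assumes dep: "\<And>x z z'. x \<in> pm_vecs \<Longrightarrow> z \<in> pm_vecs \<Longrightarrow> z' \<in> pm_vecs \<Longrightarrow>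
      (\<forall>i\<in>A. z i = z' i) \<Longrightarrow> F x z = F x z'"
    and i: "i \<in> T" "i \<notin> A"
  shows "fourier_coeff F S T = 0"
proof -
  have "(\<Sum>z\<in>pm_vecs. F x z * (\<Prod>i\<in>S. x i) * (\<Prod>i\<in>T. z i)) = 0" if x: "x \<in> pm_vecs" for x
  proof -
    let ?flip = "\<lambda>z :: 'b \<Rightarrow> real. z(i := - z i)"
    let ?f = "\<lambda>z. F x z * (\<Prod>i\<in>S. x i) * (\<Prod>i\<in>T. z i)"
    have "?f (?flip z) = - ?f z" if z: "z \<in> pm_vecs" for z
    proof -
      have "?flip z \<in> pm_vecs" using z by (auto simp: pm_vecs_def)
      then have "F x (?flip z) = F x z" using dep[OF x _ z, of "?flip z"] i by auto
      moreover have "(\<Prod>k\<in>T. ?flip z k) = - (\<Prod>k\<in>T. z k)"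
      proof -
        have "(\<Prod>k\<in>T - {i}. ?flip z k) = (\<Prod>k\<in>T - {i}. z k)" by (intro prod.cong) auto
        then show ?thesis using prod.remove[of T i "?flip z"] prod.remove[of T i z] i by simp
      qed
      ultimately show ?thesis by simp
    qed
    then have "(\<Sum>z\<in>pm_vecs. ?f z) = (\<Sum>z\<in>pm_vecs. - ?f z)"
      by (intro sum.reindex_bij_witness[where i = ?flip and j = ?flip]) (auto simp: pm_vecs_def)
    then show ?thesis by (simp add: sum_negf)
  qed
  then show ?thesis by (simp add: fourier_coeff_def)
qed

text \<open>Since coefficients with \<open>T\<close> outside \<open>A\<close> vanish, the foreign
  atoms may be frozen at 0. They then have zero derivative, so that only the atoms of the constraint
  count and \<open>beta\<close> can enter the estimate.\<close>

lemma fourier_expansion_dependent: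
  fixes F :: "('n::finite \<Rightarrow> real) \<Rightarrow> ('k::finite \<Rightarrow> real) \<Rightarrow> real"
  assumes dep: "\<And>x z z'. x \<in> pm_vecs \<Longrightarrow> z \<in> pm_vecs \<Longrightarrow> z' \<in> pm_vecs \<Longrightarrow>
      (\<forall>i\<in>A. z i = z' i) \<Longrightarrow> F x z = F x z'"
  shows "(\<Sum>S\<in>Pow UNIV. \<Sum>T\<in>Pow UNIV. fourier_coeff F S T * (\<Prod>i\<in>S. a i) * (\<Prod>i\<in>T. d i)) =
    mlext (join_fun F) (case_sum a (\<lambda>i. if i \<in> A then d i else 0))"
  unfolding fourier_expansion[symmetric]
proof (intro sum.cong refl)
  fix S :: "'n set" and T :: "'k set"
  show "fourier_coeff F S T * (\<Prod>i\<in>S. a i) * (\<Prod>i\<in>T. d i) =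
    fourier_coeff F S T * (\<Prod>i\<in>S. a i) * (\<Prod>i\<in>T. if i \<in> A then d i else 0)"
  proof (cases "T \<subseteq> A")
    case True
    then have "(\<Prod>i\<in>T. d i) = (\<Prod>i\<in>T. if i \<in> A then d i else 0)" by (intro prod.cong) auto
    then show ?thesis by simp
  next
    case False
    then obtain i where "i \<in> T" "i \<notin> A" by auto
    then have "fourier_coeff F S T = 0" by (intro fourier_coeff_eq_0[OF dep])
    then show ?thesis by simp
  qed
qed

section \<open>The constants behind \<open>Lconst\<close>\<close>

text \<open>As \<open>\<bar>q i $ j\<bar> \<le> norm (q i)\<close>, each atom charges
  \<open>\<bar>v $ j\<bar>\<close> at most once for every real variable \<open>j\<close> in its
  support. Exchanging the sums counts, for each \<open>j\<close>, the atoms of \<open>c\<close> that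
  contain it.\<close>

lemma sum_abs_inner_le_beta:
  fixes q :: "'k::finite \<Rightarrow> real^'m::finite"
  assumes "finite Cs" "c \<in> Cs"
  shows "(\<Sum>i\<in>atm c. \<bar>q i \<bullet> v\<bar> / norm (q i)) \<le> real (beta Cs atm q) * (\<Sum>j\<in>UNIV. \<bar>v $ j\<bar>)"
proof -
  have le_beta: "card {i\<in>atm c. q i $ j \<noteq> 0} \<le> beta Cs atm q" for j
  proof -
    have "{card {i\<in>atm c. q i $ j \<noteq> 0} | c j. c \<in> Cs} =
        (\<lambda>(c, j). card {i\<in>atm c. q i $ j \<noteq> 0}) ` (Cs \<times> UNIV)" by auto
    then have "finite {card {i\<in>atm c. q i $ j \<noteq> 0} | c j. c \<in> Cs}" using assms(1) by simp
    then show ?thesis unfolding beta_def using assms(2) by (intro Max_ge) auto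
  qed
  have "\<bar>q i \<bullet> v\<bar> / norm (q i) \<le> (\<Sum>j\<in>UNIV. if q i $ j \<noteq> 0 then \<bar>v $ j\<bar> else 0)" for i
  proof (cases "q i = 0")
    case False
    have "\<bar>q i \<bullet> v\<bar> \<le> (\<Sum>j\<in>UNIV. \<bar>q i $ j\<bar> * \<bar>v $ j\<bar>)"
      unfolding inner_vec_def by (rule order_trans[OF sum_abs]) (simp add: abs_mult)
    also have "\<dots> \<le> (\<Sum>j\<in>UNIV. norm (q i) * (if q i $ j \<noteq> 0 then \<bar>v $ j\<bar> else 0))"
      by (intro sum_mono) (auto simp: component_le_norm_cart mult_right_mono)
    finally show ?thesis using False by (simp add: sum_distrib_left[symmetric] field_simps)
  qed simp
  then have "(\<Sum>i\<in>atm c. \<bar>q i \<bullet> v\<bar> / norm (q i)) \<le>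
      (\<Sum>i\<in>atm c. \<Sum>j\<in>UNIV. if q i $ j \<noteq> 0 then \<bar>v $ j\<bar> else 0)"
    by (rule sum_mono)
  also have "\<dots> = (\<Sum>j\<in>UNIV. real (card {i\<in>atm c. q i $ j \<noteq> 0}) * \<bar>v $ j\<bar>)"
    by (subst sum.swap) (simp add: sum.If_cases Int_def)
  also have "\<dots> \<le> (\<Sum>j\<in>UNIV. real (beta Cs atm q) * \<bar>v $ j\<bar>)"
    using le_beta by (intro sum_mono mult_right_mono) auto
  finally show ?thesis by (simp add: sum_distrib_left)
qed

text \<open>Cauchy--Schwarz with the vector that is 1 on the propositional and
  \<open>\<gamma>\<close> on the real coordinates.\<close>

lemma sum_abs_pair_le:
  fixes p :: "(real^'n::finite) \<times> (real^'m::finite)"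
  shows "((\<Sum>i\<in>UNIV. \<bar>fst p $ i\<bar>) + \<gamma> * (\<Sum>j\<in>UNIV. \<bar>snd p $ j\<bar>))\<^sup>2 \<le>
    (real CARD('n) + real CARD('m) * \<gamma>\<^sup>2) * (norm p)\<^sup>2"
proof -
  let ?x = "(\<chi> i. 1, \<chi> j. \<gamma>) :: (real^'n) \<times> (real^'m)"
  let ?y = "(\<chi> i. \<bar>fst p $ i\<bar>, \<chi> j. \<bar>snd p $ j\<bar>) :: (real^'n) \<times> (real^'m)"
  have "?x \<bullet> ?y = (\<Sum>i\<in>UNIV. \<bar>fst p $ i\<bar>) + \<gamma> * (\<Sum>j\<in>UNIV. \<bar>snd p $ j\<bar>)"
    by (simp add: inner_vec_def sum_distrib_left)
  moreover have "?x \<bullet> ?x = real CARD('n) + real CARD('m) * \<gamma>\<^sup>2"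
    by (simp add: inner_vec_def power2_eq_square)
  moreover have "?y \<bullet> ?y = (norm p)\<^sup>2"
    by (cases p) (simp add: inner_vec_def power2_norm_eq_inner)
  ultimately show ?thesis using Cauchy_Schwarz_ineq[of ?x ?y] by simp
qed

text \<open>The curvature estimate yields \<open>\<alpha> * X\<close> with
  \<open>X = n + m * \<gamma>\<^sup>2\<close>. Splitting \<open>X\<close> into two square roots and
  bounding one of them by \<open>sqrt (n + m) * max 1 \<gamma>\<close> produces
  \<open>Lconst\<close>.\<close>

lemma Lconst_ge:
  assumes "\<alpha> \<ge> 0" "\<sigma> > 0"
  shows "\<alpha> * (real n + real m * (gauss_rate \<sigma> * real \<beta>)\<^sup>2) \<le> Lconst n m \<alpha> \<sigma> \<beta>"
proof -
  define \<gamma> where "\<gamma> = gauss_rate \<sigma> * real \<beta>"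
  define X where "X = real n + real m * \<gamma>\<^sup>2"
  have g0: "\<gamma> \<ge> 0" using assms by (simp add: \<gamma>_def gauss_rate_def)
  have X0: "X \<ge> 0" by (simp add: X_def)
  have "1 \<le> (max 1 \<gamma>)\<^sup>2" by (simp add: one_le_power)
  moreover have "\<gamma>\<^sup>2 \<le> (max 1 \<gamma>)\<^sup>2" using g0 by (intro power_mono) auto
  ultimately have "X \<le> real n * (max 1 \<gamma>)\<^sup>2 + real m * (max 1 \<gamma>)\<^sup>2"
    unfolding X_def using mult_left_mono[of 1 "(max 1 \<gamma>)\<^sup>2" "real n"]
    by (intro add_mono mult_left_mono) auto
  also have "\<dots> = (real n + real m) * (max 1 \<gamma>)\<^sup>2" by (simp add: algebra_simps)
  finally have "sqrt X \<le> sqrt ((real n + real m) * (max 1 \<gamma>)\<^sup>2)" by simp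
  then have "sqrt X \<le> sqrt (real n + real m) * max 1 \<gamma>" by (simp add: real_sqrt_mult)
  then have "\<alpha> * sqrt X * sqrt X \<le> \<alpha> * sqrt X * (sqrt (real n + real m) * max 1 \<gamma>)"
    using assms X0 by (intro mult_left_mono) auto
  then have "\<alpha> * X \<le> sqrt X * \<alpha> * sqrt (real n + real m) * max 1 \<gamma>"
    using X0 by (simp add: mult_ac)
  moreover have "sqrt 2 * real \<beta> / (sqrt pi * \<sigma>) = \<gamma>" by (simp add: \<gamma>_def gauss_rate_def)
  ultimately show ?thesis by (simp add: Lconst_def X_def \<gamma>_def[symmetric])
qed

section \<open>The domain, and the gradient as a derivative\<close>

text \<open>Each comparison cuts out a half-space or a hyperplane. Strict comparisons can make the
  domain fail to be closed, which is why the estimates are carried over to its closure.\<close>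

lemma convex_Dom: "convex (Dom Cs F atm q q0 rel)"
proof -
  have half: "convex {p :: (real^'a) \<times> (real^'b). cmp_holds r (q i \<bullet> snd p - q0 i)}" for r i
  proof -
    have "convex {y. cmp_holds r (q i \<bullet> y - q0 i)}"
      by (cases r) (auto simp: convex_halfspace_le convex_halfspace_lt convex_halfspace_ge
          convex_halfspace_gt convex_hyperplane)
    then have "convex (snd -` {y. cmp_holds r (q i \<bullet> y - q0 i)} :: ((real^'a) \<times> (real^'b)) set)"
      by (rule convex_linear_vimage[OF linear_snd])
    then show ?thesis by (simp add: vimage_def)
  qed
  have box: "convex {p :: (real^'a) \<times> (real^'b). fst p $ i \<in> {-1..1}}" for i
    using convex_linear_vimage[of "\<lambda>p :: (real^'a) \<times> (real^'b). fst p $ i" "{-1..1}"]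
    by (simp add: vimage_def linear_iff)
  have "Dom Cs F atm q q0 rel = (\<Inter>i. {p. fst p $ i \<in> {-1..1}}) \<inter>
      (\<Inter>(c, i)\<in>{(c, i). c \<in> Cs \<and> single_atom (F c) (atm c) i}. {p. cmp_holds (rel i) (q i \<bullet> snd p - q0 i)})"
    by (auto simp: Dom_def atom_holds_def)
  then show ?thesis by (simp only:) (intro convex_Int convex_INT; auto simp: half box simp del: atLeastAtMost_iff)
qed

lemma closure_Dom_box: "p \<in> closure (Dom Cs F atm q q0 rel) \<Longrightarrow> \<bar>fst p $ i\<bar> \<le> 1"
proof -
  assume p: "p \<in> closure (Dom Cs F atm q q0 rel)"
  have "closed {p :: (real^'a) \<times> (real^'b). \<bar>fst p $ i\<bar> \<le> 1}"
    by (intro closed_Collect_le continuous_intros)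
  moreover have "Dom Cs F atm q q0 rel \<subseteq> {p. \<bar>fst p $ i\<bar> \<le> 1}" by (auto simp: Dom_def abs_le_iff)
  ultimately show ?thesis using p closure_minimal by blast
qed

text \<open>The definite description in \<open>grad\<close> is justified by Riesz representation:
  the adjoint of the derivative, applied to 1, is a gradient, and it is the only one.\<close>

lemma has_derivative_grad:
  fixes f :: "'a::euclidean_space \<Rightarrow> real"
  assumes "f differentiable (at p)"
  shows "(f has_derivative (\<lambda>h. h \<bullet> grad f p)) (at p)"
proof -
  obtain D where D: "(f has_derivative D) (at p)" using assms by (auto simp: differentiable_def)
  have "D = (\<lambda>h. h \<bullet> adjoint D 1)"
    using adjoint_works[OF has_derivative_linear[OF D], of _ 1] by (simp add: fun_eq_iff)
  then have ex: "GDERIV f p :> adjoint D 1" using D by (simp add: gderiv_def)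
  have "G = adjoint D 1" if "GDERIV f p :> G" for G
  proof -
    have "(\<lambda>h. h \<bullet> G) = (\<lambda>h. h \<bullet> adjoint D 1)"
      using that ex unfolding gderiv_def by (rule has_derivative_unique)
    then show ?thesis by (metis vector_eq_ldot)
  qed
  with ex have "grad f p = adjoint D 1" unfolding grad_def by blast
  with ex show ?thesis by (simp add: gderiv_def)
qed

lemma differentiable_prod:
  fixes f :: "'i \<Rightarrow> 'a::real_normed_vector \<Rightarrow> real"
  assumes "\<And>i. i \<in> I \<Longrightarrow> f i differentiable (at x within S)"
  shows "(\<lambda>x. \<Prod>i\<in>I. f i x) differentiable (at x within S)"
  using assms by (induction I rule: infinite_finite_induct) auto

lemma Csigma_eq_mlext:
  assumes dep: "\<forall>c\<in>Cs. \<forall>x\<in>pm_vecs. \<forall>z\<in>pm_vecs. \<forall>z'\<in>pm_vecs.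
      (\<forall>i\<in>atm c. z i = z' i) \<longrightarrow> F c x z = F c x z'"
  shows "Csigma \<sigma> Cs w F q q0 rel p = (\<Sum>c\<in>Cs. w c * mlext (join_fun (F c))
    (case_sum (\<lambda>i. fst p $ i) (\<lambda>i. if i \<in> atm c then smoothed_delta \<sigma> q q0 rel i (snd p) else 0)))"
  unfolding Csigma_def
  by (intro sum.cong refl arg_cong2[where f = "(*)"] fourier_expansion_dependent) (use dep in blast)

lemma abs_join_fun_le:
  assumes "\<forall>x\<in>pm_vecs. \<forall>z\<in>pm_vecs. F x z \<in> {-1, 1}" "s \<in> pm_vecs"
  shows "\<bar>join_fun F s\<bar> \<le> 1"
  using assms unfolding join_fun_def pm_vecs_sum_type_iff[of s] by fastforce

lemma abs_smoothed_delta_le: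
  "q i \<noteq> 0 \<Longrightarrow> \<sigma> > 0 \<Longrightarrow> \<bar>smoothed_delta \<sigma> q q0 rel i b\<bar> \<le> 1"
  by (metis smoothed_delta_profile[of q i \<sigma> q0 rel])

lemma differentiable_smoothed_delta:
  assumes "q i \<noteq> 0" "\<sigma> > 0"
  shows "(\<lambda>p. smoothed_delta \<sigma> q q0 rel i (snd p)) differentiable (at p)"
proof -
  obtain h h1 h2 where "\<And>b. smoothed_delta \<sigma> q q0 rel i b = h (q i \<bullet> b)"
    and "\<And>x. (h has_real_derivative h1 x) (at x)"
    using smoothed_delta_profile[of q i \<sigma> q0 rel, OF assms] by metis
  note h = this
  have "((\<lambda>p. q i \<bullet> snd p) has_derivative (\<lambda>v. q i \<bullet> snd v)) (at p)"
    by (auto intro!: derivative_eq_intros)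
  from has_derivative_compose[OF this h(2)[unfolded has_field_derivative_def]]
  show ?thesis unfolding differentiable_def h(1) by blast
qed

lemma differentiable_Csigma:
  fixes q :: "'k::finite \<Rightarrow> real^'m::finite" and p :: "(real^'n::finite) \<times> (real^'m)"
  assumes "\<forall>i. q i \<noteq> 0" "\<sigma> > 0"
  shows "Csigma \<sigma> Cs w F q q0 rel differentiable (at p)"
proof -
  have "(\<lambda>p :: (real^'n) \<times> (real^'m). fst p $ i) differentiable (at p)" for i
    by (rule bounded_linear_imp_differentiable) (intro bounded_linear_vec_nth[THEN bounded_linear_compose] bounded_linear_fst)
  \<comment> \<open>For infinite \<open>Cs\<close> the sum takes its default value 0, which is
    differentiable as well.\<close>
  then show ?thesis
    using assms unfolding Csigma_def[abs_def]
    by (cases "finite Cs")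
      (auto intro!: differentiable_sum differentiable_mult differentiable_prod differentiable_smoothed_delta)
qed

text \<open>Instance of \<open>mlext_curve_derivs\<close> along a line: propositional coordinates
  move affinely, atoms follow their profiles, and the sum of the speed bounds is estimated through
  \<open>beta\<close> and Cauchy--Schwarz.\<close>

lemma mlext_line_derivs:
  fixes q :: "'k::finite \<Rightarrow> real^'m::finite" and p h :: "(real^'n::finite) \<times> (real^'m)"
    and atm :: "'c \<Rightarrow> 'k set" and q0 :: "'k \<Rightarrow> real" and rel :: "'k \<Rightarrow> cmp"
  assumes "finite Cs" "c \<in> Cs" "\<forall>i. q i \<noteq> 0" "\<sigma> > 0"
    and G: "\<And>s. s \<in> pm_vecs \<Longrightarrow> \<bar>G s\<bar> \<le> 1"
  defines "M \<equiv> \<lambda>p :: (real^'n) \<times> (real^'m). mlext G (case_sum (\<lambda>i. fst p $ i)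
    (\<lambda>i. if i \<in> atm c then smoothed_delta \<sigma> q q0 rel i (snd p) else 0))"
  shows "\<exists>m1 m2. (\<forall>t. ((\<lambda>t. M (p + t *\<^sub>R h)) has_real_derivative m1 t) (at t)) \<and>
    (\<forall>t. (m1 has_real_derivative m2 t) (at t)) \<and>
    (\<forall>t. (\<forall>i. \<bar>fst (p + t *\<^sub>R h) $ i\<bar> \<le> 1) \<longrightarrow> \<bar>m2 t\<bar> \<le>
      (real CARD('n) + real CARD('m) * (gauss_rate \<sigma> * real (beta Cs atm q))\<^sup>2) * (norm h)\<^sup>2)"
proof -
  \<comment> \<open>Each atom's profile and its two derivatives are packed into a triple so that one
    choice serves all atoms.\<close>
  have "\<exists>H. \<forall>i. (\<forall>b. smoothed_delta \<sigma> q q0 rel i b = fst (H i) (q i \<bullet> b)) \<and>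
    (\<forall>x. \<bar>fst (H i) x\<bar> \<le> 1) \<and>
    (\<forall>x. (fst (H i) has_real_derivative fst (snd (H i)) x) (at x)) \<and>
    (\<forall>x. (fst (snd (H i)) has_real_derivative snd (snd (H i)) x) (at x)) \<and>
    (\<forall>x. \<bar>fst (snd (H i)) x\<bar> \<le> gauss_rate \<sigma> / norm (q i)) \<and>
    (\<forall>x. \<bar>snd (snd (H i)) x\<bar> \<le> (gauss_rate \<sigma> / norm (q i))\<^sup>2)"
  proof (rule choice, rule allI)
    fix i
    obtain h h1 h2 where "\<And>b. smoothed_delta \<sigma> q q0 rel i b = h (q i \<bullet> b)"
      and "\<And>x. \<bar>h x\<bar> \<le> 1"
      and "\<And>x. (h has_real_derivative h1 x) (at x)"
      and "\<And>x. (h1 has_real_derivative h2 x) (at x)"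
      and "\<And>x. \<bar>h1 x\<bar> \<le> gauss_rate \<sigma> / norm (q i)"
      and "\<And>x. \<bar>h2 x\<bar> \<le> (gauss_rate \<sigma> / norm (q i))\<^sup>2"
      using assms(3,4) by (blast intro: smoothed_delta_profile[of q i \<sigma> q0 rel])
    then show "\<exists>H. (\<forall>b. smoothed_delta \<sigma> q q0 rel i b = fst H (q i \<bullet> b)) \<and>
      (\<forall>x. \<bar>fst H x\<bar> \<le> 1) \<and>
      (\<forall>x. (fst H has_real_derivative fst (snd H) x) (at x)) \<and>
      (\<forall>x. (fst (snd H) has_real_derivative snd (snd H) x) (at x)) \<and>
      (\<forall>x. \<bar>fst (snd H) x\<bar> \<le> gauss_rate \<sigma> / norm (q i)) \<and>
      (\<forall>x. \<bar>snd (snd H) x\<bar> \<le> (gauss_rate \<sigma> / norm (q i))\<^sup>2)"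
      by (intro exI[of _ "(h, h1, h2)"]) simp
  qed
  then obtain H where H: "smoothed_delta \<sigma> q q0 rel i b = fst (H i) (q i \<bullet> b)"
    "\<bar>fst (H i) x\<bar> \<le> 1"
    "(fst (H i) has_real_derivative fst (snd (H i)) x) (at x)"
    "(fst (snd (H i)) has_real_derivative snd (snd (H i)) x) (at x)"
    "\<bar>fst (snd (H i)) x\<bar> \<le> gauss_rate \<sigma> / norm (q i)"
    "\<bar>snd (snd (H i)) x\<bar> \<le> (gauss_rate \<sigma> / norm (q i))\<^sup>2" for i b x
    by auto
  define y where "y i t = q i \<bullet> snd p + t * (q i \<bullet> snd h)" for i t
  have dy: "(y i has_real_derivative q i \<bullet> snd h) (at t)" for i t
    unfolding y_def by (auto intro!: derivative_eq_intros)
  define e where "e = case_sum (\<lambda>i t. fst p $ i + t * fst h $ i)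
    (\<lambda>i t. if i \<in> atm c then fst (H i) (y i t) else 0)"
  define e1 where "e1 = case_sum (\<lambda>i (t::real). fst h $ i)
    (\<lambda>i t. if i \<in> atm c then fst (snd (H i)) (y i t) * (q i \<bullet> snd h) else 0)"
  define e2 where "e2 = case_sum (\<lambda>(i::'n) (t::real). 0)
    (\<lambda>i t. if i \<in> atm c then snd (snd (H i)) (y i t) * (q i \<bullet> snd h)\<^sup>2 else 0)"
  \<comment> \<open>Speed bounds: exact for the affine coordinates, whose second derivative is 0,
    and slope bound times \<open>\<bar>q i \<bullet> snd h\<bar>\<close> for the atoms of
    \<open>c\<close>.\<close>
  define u where "u = case_sum (\<lambda>i. \<bar>fst h $ i\<bar>)
    (\<lambda>i. if i \<in> atm c then gauss_rate \<sigma> / norm (q i) * \<bar>q i \<bullet> snd h\<bar> else 0)"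
  let ?\<gamma> = "gauss_rate \<sigma> * real (beta Cs atm q)"
  have rate: "gauss_rate \<sigma> \<ge> 0" using \<open>\<sigma> > 0\<close> by (simp add: gauss_rate_def)
  have M: "M (p + t *\<^sub>R h) = mlext G (\<lambda>k. e k t)" for t
    unfolding M_def
    by (rule arg_cong[where f = "mlext G"])
      (auto simp: fun_eq_iff e_def H(1) y_def inner_add_right split: sum.split)
  have "(e k has_real_derivative e1 k t) (at t)" for k t
    unfolding e_def e1_def
    by (cases k) (auto intro!: derivative_eq_intros DERIV_chain2[OF H(3) dy])
  moreover have "(e1 k has_real_derivative e2 k t) (at t)" for k t
    unfolding e1_def e2_def
    by (cases k) (auto intro!: derivative_eq_intros DERIV_chain2[OF H(4) dy] simp: power2_eq_square)
  moreover have "\<bar>e1 k t\<bar> \<le> u k" for k t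
    unfolding e1_def u_def by (cases k) (auto simp: abs_mult simp del: times_divide_eq_left intro!: mult_right_mono H)
  moreover have "\<bar>e2 k t\<bar> \<le> (u k)\<^sup>2" for k t
    unfolding e2_def u_def
    by (cases k) (auto simp: abs_mult power_mult_distrib simp del: times_divide_eq_left intro!: mult_right_mono H)
  ultimately have "\<exists>m1 m2. (\<forall>t. ((\<lambda>t. mlext G (\<lambda>k. e k t)) has_real_derivative m1 t) (at t)) \<and>
    (\<forall>t. (m1 has_real_derivative m2 t) (at t)) \<and>
    (\<forall>t. (\<forall>k. \<bar>e k t\<bar> \<le> 1) \<longrightarrow> \<bar>m2 t\<bar> \<le> (\<Sum>k\<in>UNIV. u k)\<^sup>2)"
    by - (rule mlext_curve_derivs[where ?e1.0 = e1 and ?e2.0 = e2], blast intro: G, assumption+)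
  then obtain m1 m2 where m: "\<forall>t. ((\<lambda>t. mlext G (\<lambda>k. e k t)) has_real_derivative m1 t) (at t)"
    "\<forall>t. (m1 has_real_derivative m2 t) (at t)"
    "\<forall>t. (\<forall>k. \<bar>e k t\<bar> \<le> 1) \<longrightarrow> \<bar>m2 t\<bar> \<le> (\<Sum>k\<in>UNIV. u k)\<^sup>2"
    by blast
  have "(\<Sum>k\<in>UNIV. u k) = (\<Sum>i\<in>UNIV. \<bar>fst h $ i\<bar>) +
      gauss_rate \<sigma> * (\<Sum>i\<in>atm c. \<bar>q i \<bullet> snd h\<bar> / norm (q i))"
    by (simp add: sum_UNIV_sum_type u_def sum.If_cases sum_distrib_left)
  also have "\<dots> \<le> (\<Sum>i\<in>UNIV. \<bar>fst h $ i\<bar>) + gauss_rate \<sigma> * (real (beta Cs atm q) * (\<Sum>j\<in>UNIV. \<bar>snd h $ j\<bar>))"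
    using assms(1,2) rate by (intro add_left_mono mult_left_mono sum_abs_inner_le_beta)
  finally have "(\<Sum>k\<in>UNIV. u k) \<le> (\<Sum>i\<in>UNIV. \<bar>fst h $ i\<bar>) + ?\<gamma> * (\<Sum>j\<in>UNIV. \<bar>snd h $ j\<bar>)"
    by (simp add: mult.assoc)
  moreover have "0 \<le> (\<Sum>k\<in>UNIV. u k)"
    using rate by (intro sum_nonneg) (auto simp: u_def split: sum.split)
  ultimately have "(\<Sum>k\<in>UNIV. u k)\<^sup>2 \<le> ((\<Sum>i\<in>UNIV. \<bar>fst h $ i\<bar>) + ?\<gamma> * (\<Sum>j\<in>UNIV. \<bar>snd h $ j\<bar>))\<^sup>2"
    by (intro power_mono)
  also have "\<dots> \<le> (real CARD('n) + real CARD('m) * ?\<gamma>\<^sup>2) * (norm h)\<^sup>2"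
    by (rule sum_abs_pair_le)
  finally have u: "(\<Sum>k\<in>UNIV. u k)\<^sup>2 \<le> (real CARD('n) + real CARD('m) * ?\<gamma>\<^sup>2) * (norm h)\<^sup>2" .
  have "\<bar>e k t\<bar> \<le> 1" if "\<forall>i. \<bar>fst (p + t *\<^sub>R h) $ i\<bar> \<le> 1" for k t
    using that H(2) by (cases k) (auto simp: e_def)
  then have "\<bar>m2 t\<bar> \<le> (real CARD('n) + real CARD('m) * ?\<gamma>\<^sup>2) * (norm h)\<^sup>2"
    if "\<forall>i. \<bar>fst (p + t *\<^sub>R h) $ i\<bar> \<le> 1" for t
    using m(3) that u by (meson order_trans)
  with m(1,2) show ?thesis unfolding M by blast
qed

lemma Csigma_quadratic_bound:
  fixes q :: "'k::finite \<Rightarrow> real^'m::finite" and p p' :: "(real^'n::finite) \<times> (real^'m)"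
    and q0 :: "'k \<Rightarrow> real" and rel :: "'k \<Rightarrow> cmp"
  assumes "finite Cs" and w: "\<forall>c\<in>Cs. w c > 0"
    and F: "\<forall>c\<in>Cs. \<forall>x\<in>pm_vecs. \<forall>z\<in>pm_vecs. F c x z \<in> {-1, 1}"
    and dep: "\<forall>c\<in>Cs. \<forall>x\<in>pm_vecs. \<forall>z\<in>pm_vecs. \<forall>z'\<in>pm_vecs.
      (\<forall>i\<in>atm c. z i = z' i) \<longrightarrow> F c x z = F c x z'"
    and q: "\<forall>i. q i \<noteq> 0" "\<sigma> > 0"
    and box: "\<forall>i. \<bar>fst p $ i\<bar> \<le> 1" "\<forall>i. \<bar>fst p' $ i\<bar> \<le> 1"
  defines "f \<equiv> Csigma \<sigma> Cs w F q q0 rel"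
  shows "f p' \<le> f p + grad f p \<bullet> (p' - p) +
    Lconst CARD('n) CARD('m) (\<Sum>c\<in>Cs. w c) \<sigma> (beta Cs atm q) / 2 * (norm (p' - p))\<^sup>2"
proof -
  define h where "h = p' - p"
  define K where "K = (real CARD('n) + real CARD('m) * (gauss_rate \<sigma> * real (beta Cs atm q))\<^sup>2) * (norm h)\<^sup>2"
  define M where "M c p = mlext (join_fun (F c)) (case_sum (\<lambda>i. fst p $ i)
    (\<lambda>i. if i \<in> atm c then smoothed_delta \<sigma> q q0 rel i (snd p) else 0))" for c p
  have "\<forall>c\<in>Cs. \<exists>m. (\<forall>t. ((\<lambda>t. M c (p + t *\<^sub>R h)) has_real_derivative fst m t) (at t)) \<and>
    (\<forall>t. (fst m has_real_derivative snd m t) (at t)) \<and>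
    (\<forall>t. (\<forall>i. \<bar>fst (p + t *\<^sub>R h) $ i\<bar> \<le> 1) \<longrightarrow> \<bar>snd m t\<bar> \<le> K)"
    unfolding M_def K_def split_paired_Ex fst_conv snd_conv
  proof (rule ballI)
    fix c assume c: "c \<in> Cs"
    have "\<bar>join_fun (F c) s\<bar> \<le> 1" if "s \<in> pm_vecs" for s
      using F c that by (intro abs_join_fun_le) auto
    then show "\<exists>m1 m2. (\<forall>t. ((\<lambda>t. mlext (join_fun (F c)) (case_sum (\<lambda>i. fst (p + t *\<^sub>R h) $ i)
          (\<lambda>i. if i \<in> atm c then smoothed_delta \<sigma> q q0 rel i (snd (p + t *\<^sub>R h)) else 0)))
          has_real_derivative m1 t) (at t)) \<and>
        (\<forall>t. (m1 has_real_derivative m2 t) (at t)) \<and>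
        (\<forall>t. (\<forall>i. \<bar>fst (p + t *\<^sub>R h) $ i\<bar> \<le> 1) \<longrightarrow> \<bar>m2 t\<bar> \<le>
          (real CARD('n) + real CARD('m) * (gauss_rate \<sigma> * real (beta Cs atm q))\<^sup>2) * (norm h)\<^sup>2)"
      by (intro mlext_line_derivs[OF assms(1) c q])
  qed
  then obtain m where m: "\<And>c t. c \<in> Cs \<Longrightarrow> ((\<lambda>t. M c (p + t *\<^sub>R h)) has_real_derivative fst (m c) t) (at t)"
    "\<And>c t. c \<in> Cs \<Longrightarrow> (fst (m c) has_real_derivative snd (m c) t) (at t)"
    "\<And>c t. c \<in> Cs \<Longrightarrow> (\<forall>i. \<bar>fst (p + t *\<^sub>R h) $ i\<bar> \<le> 1) \<Longrightarrow> \<bar>snd (m c) t\<bar> \<le> K"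
    by metis
  define \<phi> where "\<phi> t = f (p + t *\<^sub>R h)" for t
  define \<phi>1 where "\<phi>1 t = (\<Sum>c\<in>Cs. w c * fst (m c) t)" for t
  define \<phi>2 where "\<phi>2 t = (\<Sum>c\<in>Cs. w c * snd (m c) t)" for t
  have "f p = (\<Sum>c\<in>Cs. w c * M c p)" for p
    unfolding f_def M_def by (rule Csigma_eq_mlext[OF dep])
  then have d1: "(\<phi> has_real_derivative \<phi>1 t) (at t)" for t
    unfolding \<phi>_def \<phi>1_def by (simp only:) (intro DERIV_sum DERIV_cmult m(1))
  have d2: "(\<phi>1 has_real_derivative \<phi>2 t) (at t)" for t
    unfolding \<phi>1_def[abs_def] \<phi>2_def by (intro DERIV_sum DERIV_cmult m(2))
  \<comment> \<open>The derivative sequence for a second-order Taylor expansion; the entries beyond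
    index 2 are mere padding.\<close>
  define diff where "diff k = (if k = 0 then \<phi> else if k = Suc 0 then \<phi>1 else \<phi>2)" for k :: nat
  have "\<exists>t. 0 < t \<and> t < 1 \<and>
      \<phi> 1 = (\<Sum>k<2. (diff k 0 / fact k) * (1 - 0)^k) + (diff 2 t / fact 2) * (1 - 0)^2"
    by (rule Taylor_up[where a = 0]) (use d1 d2 in \<open>auto simp: diff_def less_2_cases_iff\<close>)
  then obtain t where t: "0 < t" "t < 1" and taylor: "\<phi> 1 = \<phi> 0 + \<phi>1 0 + \<phi>2 t / 2"
    by (auto simp: diff_def numeral_2_eq_2)
  \<comment> \<open>The intermediate point is a convex combination of \<open>p\<close> and
    \<open>p'\<close>, so it stays in the cube, where the curvature bound holds.\<close>
  have line: "\<bar>fst (p + t *\<^sub>R h) $ i\<bar> \<le> 1" for i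
  proof -
    have "fst (p + t *\<^sub>R h) $ i = (1 - t) * fst p $ i + t * fst p' $ i"
      by (simp add: h_def algebra_simps)
    also have "\<bar>\<dots>\<bar> \<le> (1 - t) * \<bar>fst p $ i\<bar> + t * \<bar>fst p' $ i\<bar>"
      using t by (intro order_trans[OF abs_triangle_ineq]) (simp add: abs_mult)
    also have "\<dots> \<le> (1 - t) * 1 + t * 1"
      using t box by (intro add_mono mult_left_mono) auto
    finally show ?thesis by simp
  qed
  have "\<phi>2 t \<le> (\<Sum>c\<in>Cs. w c * K)"
    unfolding \<phi>2_def using m(3) line w by (intro sum_mono mult_left_mono) (auto simp: abs_le_iff less_imp_le)
  also have "\<dots> \<le> Lconst CARD('n) CARD('m) (\<Sum>c\<in>Cs. w c) \<sigma> (beta Cs atm q) * (norm h)\<^sup>2"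
  proof -
    have "(\<Sum>c\<in>Cs. w c) \<ge> 0" using w by (intro sum_nonneg) (auto simp: less_imp_le)
    from mult_right_mono[OF Lconst_ge[OF this q(2)], of "(norm h)\<^sup>2"] show ?thesis
      unfolding K_def by (simp add: sum_distrib_right[symmetric] mult.assoc)
  qed
  finally have "\<phi>2 t \<le> Lconst CARD('n) CARD('m) (\<Sum>c\<in>Cs. w c) \<sigma> (beta Cs atm q) * (norm h)\<^sup>2" .
  \<comment> \<open>The chain rule gives a second expression for the derivative of
    \<open>\<phi>\<close> at 0, and uniqueness of derivatives identifies the linear Taylor
    term.\<close>
  moreover have "\<phi>1 0 = grad f p \<bullet> h"
  proof -
    have "f differentiable (at p)" unfolding f_def by (rule differentiable_Csigma[OF q])
    then have grad: "(f has_derivative (\<lambda>h. h \<bullet> grad f p)) (at p)"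
      by (rule has_derivative_grad)
    have "((\<lambda>t. p + t *\<^sub>R h) has_derivative (\<lambda>t. t *\<^sub>R h)) (at 0)"
      by (auto intro!: derivative_eq_intros)
    from has_derivative_compose[OF this, of f "\<lambda>h. h \<bullet> grad f p"] grad
    have "(\<phi> has_derivative (\<lambda>t. t *\<^sub>R h \<bullet> grad f p)) (at 0)"
      by (simp add: \<phi>_def[abs_def])
    then have "(\<phi> has_real_derivative h \<bullet> grad f p) (at 0)"
      by (simp add: has_field_derivative_def mult_commute_abs)
    then show ?thesis using d1[of 0] by (simp add: DERIV_unique inner_commute)
  qed
  ultimately show ?thesis using taylor by (simp add: \<phi>_def h_def)
qed

lemma abs_Csigma_le:
  assumes w: "\<forall>c\<in>Cs. w c > 0"
    and F: "\<forall>c\<in>Cs. \<forall>x\<in>pm_vecs. \<forall>z\<in>pm_vecs. F c x z \<in> {-1, 1}"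
    and q: "\<forall>i. q i \<noteq> 0" "\<sigma> > 0" and box: "\<forall>i. \<bar>fst p $ i\<bar> \<le> 1"
  shows "\<bar>Csigma \<sigma> Cs w F q q0 rel p\<bar> \<le> (\<Sum>c\<in>Cs. w c)"
proof -
  have "\<bar>w c * mlext (join_fun (F c)) (case_sum (\<lambda>i. fst p $ i) (\<lambda>i. smoothed_delta \<sigma> q q0 rel i (snd p)))\<bar> \<le> w c"
    if c: "c \<in> Cs" for c
  proof -
    have "\<bar>mlext (join_fun (F c)) (case_sum (\<lambda>i. fst p $ i) (\<lambda>i. smoothed_delta \<sigma> q q0 rel i (snd p)))\<bar> \<le> 1"
      using F c box q
      by (intro abs_mlext_le_1 abs_join_fun_le) (auto simp: abs_smoothed_delta_le split: sum.split)
    moreover have "\<bar>w c\<bar> = w c" using w c by (simp add: less_imp_le)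
    ultimately show ?thesis using w c by (simp add: abs_mult mult_left_le less_imp_le)
  qed
  then show ?thesis unfolding Csigma_def fourier_expansion
    by (intro order_trans[OF sum_abs] sum_mono)
qed

text \<open>The constant hidden in the asymptotic bound is explicit: the factor 4 is the 2 of the
  per-step estimate times the 2 in the length \<open>2 * \<alpha>\<close> of the range of the
  objective.\<close>

theorem theorem7:
  fixes Cs :: "'c set"
    and w :: "'c \<Rightarrow> real"
    and F :: "'c \<Rightarrow> ('n::finite \<Rightarrow> real) \<Rightarrow> ('k::finite \<Rightarrow> real) \<Rightarrow> real"
    and atm :: "'c \<Rightarrow> 'k set"
    and q :: "'k \<Rightarrow> real^'m::finite"
    and q0 :: "'k \<Rightarrow> real"
    and rel :: "'k \<Rightarrow> cmp"
    and \<sigma> \<epsilon> :: real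
    and p0 :: "(real^'n) \<times> (real^'m)"
  assumes "finite Cs"
    and "\<forall>c\<in>Cs. w c > 0"
    and "\<forall>c\<in>Cs. \<forall>x\<in>pm_vecs. \<forall>z\<in>pm_vecs. F c x z \<in> {-1, 1}"
    and "\<forall>c\<in>Cs. \<forall>x\<in>pm_vecs. \<forall>z\<in>pm_vecs. \<forall>z'\<in>pm_vecs.
           (\<forall>i\<in>atm c. z i = z' i) \<longrightarrow> F c x z = F c x z'"
    and "\<forall>i. q i \<noteq> 0"
    and "\<sigma> > 0"
    and "\<epsilon> > 0"
    and "p0 \<in> Dom Cs F atm q q0 rel"
  shows "let \<alpha> = (\<Sum>c\<in>Cs. w c);
             L = Lconst CARD('n) CARD('m) \<alpha> \<sigma> (beta Cs atm q);
             C = Csigma \<sigma> Cs w F q q0 rel;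
             D = Dom Cs F atm q q0 rel
         in \<exists>t::nat. real t \<le> 4 * \<alpha> * L / \<epsilon>\<^sup>2 \<and>
              (norm (grad_map (1 / L) C D ((pgd_step (1 / L) C D ^^ t) p0)))\<^sup>2 \<le> \<epsilon>\<^sup>2"
proof (cases "Cs = {}")
  case True
  \<comment> \<open>Here \<open>L = 0\<close>, the step size \<open>1 / L\<close> is the junk value 0, and so is the gradient mapping.\<close>
  then show ?thesis by (auto simp: Let_def Lconst_def grad_map_def intro!: exI[of _ 0])
next
  case False
  define \<alpha> where "\<alpha> = (\<Sum>c\<in>Cs. w c)"
  define L where "L = Lconst CARD('n) CARD('m) \<alpha> \<sigma> (beta Cs atm q)"
  have \<alpha>: "\<alpha> > 0" unfolding \<alpha>_def using assms(1,2) False by (intro sum_pos) auto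
  \<comment> \<open>The index type \<open>'n\<close> is nonempty, so this lower bound for
    \<open>L\<close> is positive even when \<open>beta\<close> is 0, and \<open>1 / L\<close> is a
    genuine step size.\<close>
  have "0 < \<alpha> * (real CARD('n) + real CARD('m) * (gauss_rate \<sigma> * real (beta Cs atm q))\<^sup>2)"
    using \<alpha> by (intro mult_pos_pos add_pos_nonneg) auto
  then have L: "L > 0"
    unfolding L_def using Lconst_ge[of \<alpha> \<sigma>] \<alpha> assms(6) less_le_trans less_imp_le by blast
  have "\<exists>t::nat. real t \<le> 4 * \<alpha> * L / \<epsilon>\<^sup>2 \<and>
    (norm (grad_map (1 / L) (Csigma \<sigma> Cs w F q q0 rel) (Dom Cs F atm q q0 rel)
      ((pgd_step (1 / L) (Csigma \<sigma> Cs w F q q0 rel) (Dom Cs F atm q q0 rel) ^^ t) p0)))\<^sup>2 \<le> \<epsilon>\<^sup>2"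
  proof (rule pgd_reaches_critical[OF convex_Dom L assms(8,7)])
    show "\<bar>Csigma \<sigma> Cs w F q q0 rel p\<bar> \<le> \<alpha>" if "p \<in> closure (Dom Cs F atm q q0 rel)" for p
      unfolding \<alpha>_def using closure_Dom_box[OF that]
      by (intro abs_Csigma_le[OF assms(2,3,5,6)]) auto
    show "Csigma \<sigma> Cs w F q q0 rel p' \<le> Csigma \<sigma> Cs w F q q0 rel p +
        grad (Csigma \<sigma> Cs w F q q0 rel) p \<bullet> (p' - p) + L / 2 * (norm (p' - p))\<^sup>2"
      if "p \<in> closure (Dom Cs F atm q q0 rel)" "p' \<in> closure (Dom Cs F atm q q0 rel)" for p p'
      unfolding L_def \<alpha>_def using closure_Dom_box[OF that(1)] closure_Dom_box[OF that(2)]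
      by (intro Csigma_quadratic_bound[OF assms(1-6)]) auto
  qed
  then show ?thesis by (simp add: Let_def \<alpha>_def L_def)
qed

end
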